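(* Let $V$ be a finite-dimensional zigzag module of length $n$ over a field $K$, let $1\le p\le q\le n$, and let $V[p,q]$ be the restriction of $V$ to $[p,q]$. Fix an interval decomposition of $V[p,q]$. The following are equivalent. (1) There exists a monomorphism $\iota:I[p,q]\to V[p,q]$ whose image is not a direct summand of $V[p,q]$. (2) The interval decomposition of $V[p,q]$ contains a breaker chain spanning $[p,q]$.
   Context: Let $K$ be a field. A zigzag module $V$ of length $n$ over $K$ consists of finite-dimensional $K$-vector spaces $V_1,\dots,V_n$ together with, for each $1\le i<n$, exactly one linear map, either $V_i\to V_{i+1}$ (a forward arrow) or $V_i\leftarrow V_{i+1}$ (a backward arrow). The sequence of arrow directions is the zigzag type; it is fixed and all modules compared have the same type. Morphisms are families of linear maps commuting with the structure maps; a monomorphism is a morphism that is injective at every vertex. For $p\le q$, the restriction $V[p,q]$ keeps only the vector spaces and arrows with indices between $p$ and $q$. Intervals $[b,d]$ are discrete (sets of integers). The interval module $I[b,d]$ (support $[b,d]$) has $I[b,d]_i=K$ for $b\le i\le d$ and $0$ otherwise, with identity maps between consecutive nonzero spaces and zero maps otherwise. A submodule $W\subseteq V$ is a family of subspaces $W_i\subseteq V_i$ preserved by all structure maps; it is a direct summand if $V=W\oplus W'$ for some submodule $W'$. An interval decomposition of $V[p,q]$ is a finite direct sum decomposition $V[p,q]=\bigoplus_{\alpha\in A}J_\alpha$ into submodules each isomorphic to an interval module $I[b,d]$ with $p\le b\le d\le q$; the $J_\alpha$ are the interval summands. Breaker pair: an ordered pair $(J_1,J_2)$ of interval summands with $J_1\cong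 I[b_1,d_1]$, $J_2\cong I[b_2,d_2]$ is a breaker pair if $b_1<b_2\le d_1<d_2$, the arrow between $b_2-1$ and $b_2$ is backward, $V_{b_2-1}\leftarrow V_{b_2}$, and the arrow between $d_1$ and $d_1+1$ is forward, $V_{d_1}\to V_{d_1+1}$. Breaker chain: a sequence of interval summands $J_1,\dots,J_r$ with $r\ge 2$ such that $(J_j,J_{j+1})$ is a breaker pair for every $1\le j<r$. Writing $J_j\cong I[b_j,d_j]$, the chain spans $[p,q]$ if $b_1=p$ and $d_r=q$. *)

theory Defs
  imports "HOL-Algebra.AbelCoset" "Jordan_Normal_Form.Missing_VectorSpace"
begin

section \<open>Zigzag modules\<close>

datatype arrow = Forward | Backward

text \<open>The vertices are the integers in \<open>{lo M..hi M}\<close>, and \<open>dir M i\<close>, \<open>smap M i\<close> describe the arrow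
  between \<open>i\<close> and \<open>i + 1\<close> for \<open>lo M \<le> i < hi M\<close>. Values outside these ranges are irrelevant.
  The spaces may all be different (each has its own carrier and operations); they only share the
  HOL type of their elements.\<close>

record ('k, 'v) zigzag =
  lo :: nat
  hi :: nat
  dir :: "nat \<Rightarrow> arrow"
  vspace :: "nat \<Rightarrow> ('k, 'v) module"
  smap :: "nat \<Rightarrow> 'v \<Rightarrow> 'v"

definition src :: "('k, 'v) zigzag \<Rightarrow> nat \<Rightarrow> nat" where
  "src M i = (case dir M i of Forward \<Rightarrow> i | Backward \<Rightarrow> Suc i)"

definition tgt :: "('k, 'v) zigzag \<Rightarrow> nat \<Rightarrow> nat" where
  "tgt M i = (case dir M i of Forward \<Rightarrow> Suc i | Backward \<Rightarrow> i)"

definition zigzag_module :: "('k, 'r) ring_scheme \<Rightarrow> ('k, 'v) zigzag \<Rightarrow> bool" where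
  "zigzag_module K M \<longleftrightarrow>
     (\<forall>i\<in>{lo M..hi M}. vectorspace K (vspace M i) \<and> vectorspace.fin_dim K (vspace M i)) \<and>
     (\<forall>i\<in>{lo M..<hi M}. linear_map K (vspace M (src M i)) (vspace M (tgt M i)) (smap M i))"

definition zz_restrict :: "('k, 'v) zigzag \<Rightarrow> nat \<Rightarrow> nat \<Rightarrow> ('k, 'v) zigzag" where
  "zz_restrict M p q = M\<lparr>lo := p, hi := q\<rparr>"


section \<open>Morphisms\<close>

definition same_type :: "('k, 'v) zigzag \<Rightarrow> ('k, 'w) zigzag \<Rightarrow> bool" where
  "same_type M N \<longleftrightarrow> lo M = lo N \<and> hi M = hi N \<and> (\<forall>i\<in>{lo M..<hi M}. dir M i = dir N i)"

definition zz_morphism ::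
  "('k, 'r) ring_scheme \<Rightarrow> ('k, 'v) zigzag \<Rightarrow> ('k, 'w) zigzag \<Rightarrow> (nat \<Rightarrow> 'v \<Rightarrow> 'w) \<Rightarrow> bool" where
  "zz_morphism K M N f \<longleftrightarrow> same_type M N \<and>
     (\<forall>i\<in>{lo M..hi M}. linear_map K (vspace M i) (vspace N i) (f i)) \<and>
     (\<forall>i\<in>{lo M..<hi M}. \<forall>x\<in>carrier (vspace M (src M i)).
        f (tgt M i) (smap M i x) = smap N i (f (src M i) x))"

definition zz_monomorphism ::
  "('k, 'r) ring_scheme \<Rightarrow> ('k, 'v) zigzag \<Rightarrow> ('k, 'w) zigzag \<Rightarrow> (nat \<Rightarrow> 'v \<Rightarrow> 'w) \<Rightarrow> bool" where
  "zz_monomorphism K M N f \<longleftrightarrow> zz_morphism K M N f \<and>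
     (\<forall>i\<in>{lo M..hi M}. inj_on (f i) (carrier (vspace M i)))"

definition zz_isomorphic :: "('k, 'r) ring_scheme \<Rightarrow> ('k, 'v) zigzag \<Rightarrow> ('k, 'w) zigzag \<Rightarrow> bool" where
  "zz_isomorphic K M N \<longleftrightarrow> (\<exists>f. zz_morphism K M N f \<and>
     (\<forall>i\<in>{lo M..hi M}. bij_betw (f i) (carrier (vspace M i)) (carrier (vspace N i))))"

definition zz_image :: "('k, 'v) zigzag \<Rightarrow> (nat \<Rightarrow> 'v \<Rightarrow> 'w) \<Rightarrow> nat \<Rightarrow> 'w set" where
  "zz_image M f = (\<lambda>i. f i ` carrier (vspace M i))"


section \<open>Submodules and direct sums\<close>

definition zz_submodule ::
  "('k, 'r) ring_scheme \<Rightarrow> ('k, 'v) zigzag \<Rightarrow> (nat \<Rightarrow> 'v set) \<Rightarrow> bool" where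
  "zz_submodule K M W \<longleftrightarrow>
     (\<forall>i\<in>{lo M..hi M}. subspace K (W i) (vspace M i)) \<and>
     (\<forall>i\<in>{lo M..<hi M}. smap M i ` W (src M i) \<subseteq> W (tgt M i))"

text \<open>A submodule as a zigzag module in its own right.\<close>

definition zz_sub :: "('k, 'v) zigzag \<Rightarrow> (nat \<Rightarrow> 'v set) \<Rightarrow> ('k, 'v) zigzag" where
  "zz_sub M W = M\<lparr>vspace := (\<lambda>i. (vspace M i)\<lparr>carrier := W i\<rparr>)\<rparr>"

definition direct_summand ::
  "('k, 'r) ring_scheme \<Rightarrow> ('k, 'v) zigzag \<Rightarrow> (nat \<Rightarrow> 'v set) \<Rightarrow> bool" where
  "direct_summand K M W \<longleftrightarrow> zz_submodule K M W \<and>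
     (\<exists>W'. zz_submodule K M W' \<and>
        (\<forall>i\<in>{lo M..hi M}. W i <+>\<^bsub>vspace M i\<^esub> W' i = carrier (vspace M i) \<and>
                           W i \<inter> W' i = {\<zero>\<^bsub>vspace M i\<^esub>}))"

definition zz_direct_sum ::
  "('k, 'r) ring_scheme \<Rightarrow> ('k, 'v) zigzag \<Rightarrow> 'a set \<Rightarrow> ('a \<Rightarrow> nat \<Rightarrow> 'v set) \<Rightarrow> bool" where
  "zz_direct_sum K M A J \<longleftrightarrow> finite A \<and> (\<forall>\<alpha>\<in>A. zz_submodule K M (J \<alpha>)) \<and>
     (\<forall>i\<in>{lo M..hi M}. \<forall>x\<in>carrier (vspace M i).
        \<exists>!w. w \<in> (\<Pi>\<^sub>E \<alpha>\<in>A. J \<alpha> i) \<and> x = (\<Oplus>\<^bsub>vspace M i\<^esub>\<alpha>\<in>A. w \<alpha>))"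


section \<open>Interval modules and interval decompositions\<close>

definition field_module :: "('k, 'r) ring_scheme \<Rightarrow> ('k, 'k) module" where
  "field_module K = \<lparr>carrier = carrier K, mult = mult K, one = one K,
                     zero = zero K, add = add K, smult = mult K\<rparr>"

text \<open>\<open>I[b,d]\<close>, of the same type and on the same vertices as \<open>M\<close>. The zero space is the subspace
  \<open>{0}\<close> of \<open>K\<close>.\<close>

definition interval_module ::
  "('k, 'r) ring_scheme \<Rightarrow> ('k, 'v) zigzag \<Rightarrow> nat \<Rightarrow> nat \<Rightarrow> ('k, 'k) zigzag" where
  "interval_module K M b d =
     \<lparr>lo = lo M, hi = hi M, dir = dir M,
      vspace = (\<lambda>i. if b \<le> i \<and> i \<le> d then field_module K
                    else (field_module K)\<lparr>carrier := {\<zero>\<^bsub>K\<^esub>}\<rparr>),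
      smap = (\<lambda>i. if b \<le> i \<and> Suc i \<le> d then (\<lambda>x. x) else (\<lambda>x. \<zero>\<^bsub>K\<^esub>))\<rparr>"

definition interval_summand ::
  "('k, 'r) ring_scheme \<Rightarrow> ('k, 'v) zigzag \<Rightarrow> (nat \<Rightarrow> 'v set) \<Rightarrow> nat \<Rightarrow> nat \<Rightarrow> bool" where
  "interval_summand K M W b d \<longleftrightarrow> lo M \<le> b \<and> b \<le> d \<and> d \<le> hi M \<and>
     zz_isomorphic K (zz_sub M W) (interval_module K M b d)"

definition interval_decomposition ::
  "('k, 'r) ring_scheme \<Rightarrow> ('k, 'v) zigzag \<Rightarrow> 'a set \<Rightarrow> ('a \<Rightarrow> nat \<Rightarrow> 'v set) \<Rightarrow> bool" where
  "interval_decomposition K M A J \<longleftrightarrow> zz_direct_sum K M A J \<and>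
     (\<forall>\<alpha>\<in>A. \<exists>b d. interval_summand K M (J \<alpha>) b d)"


section \<open>Breaker chains\<close>

definition breaker_pair ::
  "('k, 'r) ring_scheme \<Rightarrow> ('k, 'v) zigzag \<Rightarrow> (nat \<Rightarrow> 'v set) \<Rightarrow> (nat \<Rightarrow> 'v set) \<Rightarrow> bool" where
  "breaker_pair K M J1 J2 \<longleftrightarrow>
     (\<exists>b1 d1 b2 d2. interval_summand K M J1 b1 d1 \<and> interval_summand K M J2 b2 d2 \<and>
        b1 < b2 \<and> b2 \<le> d1 \<and> d1 < d2 \<and>
        dir M (b2 - 1) = Backward \<and> dir M d1 = Forward)"

definition breaker_chain ::
  "('k, 'r) ring_scheme \<Rightarrow> ('k, 'v) zigzag \<Rightarrow> 'a set \<Rightarrow> ('a \<Rightarrow> nat \<Rightarrow> 'v set) \<Rightarrow> 'a list \<Rightarrow> bool" where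
  "breaker_chain K M A J \<alpha>s \<longleftrightarrow> 2 \<le> length \<alpha>s \<and> set \<alpha>s \<subseteq> A \<and>
     (\<forall>j. Suc j < length \<alpha>s \<longrightarrow> breaker_pair K M (J (\<alpha>s ! j)) (J (\<alpha>s ! Suc j)))"

definition chain_spans ::
  "('k, 'r) ring_scheme \<Rightarrow> ('k, 'v) zigzag \<Rightarrow> ('a \<Rightarrow> nat \<Rightarrow> 'v set) \<Rightarrow> 'a list \<Rightarrow> nat \<Rightarrow> nat \<Rightarrow> bool" where
  "chain_spans K M J \<alpha>s p q \<longleftrightarrow>
     (\<exists>d. interval_summand K M (J (hd \<alpha>s)) p d) \<and> (\<exists>b. interval_summand K M (J (last \<alpha>s)) b q)"

end

theory Submission
  imports Defs
begin

text \<open>A monomorphism from \<open>I[p,q]\<close> amounts to nonzero vectors \<open>v\<^sub>i \<in> V\<^sub>i\<close> matched by the structure maps.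
  Expanding them in the interval decomposition gives on each summand \<open>J\<^sub>\<alpha>\<close> a coordinate that is constant on
  its interval \<open>[b,d]\<close>, and a nonzero constant forces the arrow before \<open>b > p\<close> to be backward and the arrow
  after \<open>d < q\<close> to be forward; conversely every choice of constants on such intervals occurs. Nonvanishing
  of the \<open>v\<^sub>i\<close> means that the intervals with nonzero coordinate cover \<open>[p,q]\<close>.

  The image is a direct summand iff one of these intervals is \<open>[p,q]\<close> itself: coordinates on such a full
  summand give a retraction, while a retraction onto the image kills every summand that is not full,
  because the arrows at its boundary point away from the interval. Finally, a covering family of intervals with
  the above arrow conditions and no full interval is the same as a spanning breaker chain: among its
  inclusion-maximal intervals, the arrow conditions force consecutive ones to overlap.\<close>

section \<open>Chains of overlapping intervals\<close>

text \<open>The chain is built leftwards from an inclusion-maximal interval that ends at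
  \<open>h\<close>. The vertex just before its left end lies in another maximal interval. That one
  cannot stop there, since the arrow between the two would have to be both \<open>Backward\<close>
  and \<open>Forward\<close>; so they overlap, and maximality orders their right ends.\<close>

lemma spanning_chain_exists:
  fixes b d :: "'a \<Rightarrow> nat" and dir :: "nat \<Rightarrow> arrow"
  assumes fin: "finite S" and "l \<le> h"
    and bounds: "\<And>\<alpha>. \<alpha> \<in> S \<Longrightarrow> l \<le> b \<alpha> \<and> b \<alpha> \<le> d \<alpha> \<and> d \<alpha> \<le> h"
    and left: "\<And>\<alpha>. \<alpha> \<in> S \<Longrightarrow> l < b \<alpha> \<Longrightarrow> dir (b \<alpha> - 1) = Backward"
    and right: "\<And>\<alpha>. \<alpha> \<in> S \<Longrightarrow> d \<alpha> < h \<Longrightarrow> dir (d \<alpha>) = Forward"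
    and cover: "\<And>i. l \<le> i \<Longrightarrow> i \<le> h \<Longrightarrow> \<exists>\<alpha>\<in>S. b \<alpha> \<le> i \<and> i \<le> d \<alpha>"
    and not_full: "\<And>\<alpha>. \<alpha> \<in> S \<Longrightarrow> \<not> (b \<alpha> = l \<and> d \<alpha> = h)"
  obtains \<alpha>s where "2 \<le> length \<alpha>s" "set \<alpha>s \<subseteq> S" "b (hd \<alpha>s) = l" "d (last \<alpha>s) = h"
    "\<And>j. Suc j < length \<alpha>s \<Longrightarrow> b (\<alpha>s ! j) < b (\<alpha>s ! Suc j) \<and> b (\<alpha>s ! Suc j) \<le> d (\<alpha>s ! j) \<and>
       d (\<alpha>s ! j) < d (\<alpha>s ! Suc j) \<and> dir (b (\<alpha>s ! Suc j) - 1) = Backward \<and> dir (d (\<alpha>s ! j)) = Forward"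
proof -
  define link where "link x y \<longleftrightarrow> b x < b y \<and> b y \<le> d x \<and> d x < d y \<and>
    dir (b y - 1) = Backward \<and> dir (d x) = Forward" for x y
  \<comment> \<open>For inclusion-maximal intervals, moving the left end also moves the right end.\<close>
  define T where "T = {\<alpha>\<in>S. \<forall>\<beta>\<in>S. {b \<alpha>..d \<alpha>} \<subseteq> {b \<beta>..d \<beta>} \<longrightarrow> {b \<beta>..d \<beta>} = {b \<alpha>..d \<alpha>}}"
  have T_cover: "\<exists>\<alpha>\<in>T. b \<alpha> \<le> i \<and> i \<le> d \<alpha>" if i: "l \<le> i" "i \<le> h" for i
  proof -
    obtain \<alpha> where \<alpha>: "\<alpha> \<in> S" "b \<alpha> \<le> i" "i \<le> d \<alpha>"
      using cover i by blast
    \<comment> \<open>Maximality is taken among the intervals as sets, because several indices may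
      carry the same interval.\<close>
    have "finite ((\<lambda>\<beta>. {b \<beta>..d \<beta>}) ` S)" "{b \<alpha>..d \<alpha>} \<in> (\<lambda>\<beta>. {b \<beta>..d \<beta>}) ` S"
      using fin \<alpha> by auto
    from finite_has_maximal2[OF this] obtain \<beta> where \<beta>: "\<beta> \<in> S" "{b \<alpha>..d \<alpha>} \<subseteq> {b \<beta>..d \<beta>}"
      "\<forall>\<gamma>\<in>S. {b \<beta>..d \<beta>} \<subseteq> {b \<gamma>..d \<gamma>} \<longrightarrow> {b \<beta>..d \<beta>} = {b \<gamma>..d \<gamma>}"
      by auto
    have "i \<in> {b \<beta>..d \<beta>}"
      using \<alpha> \<beta>(2) by (meson atLeastAtMost_iff subsetD)
    moreover have "\<beta> \<in> T"
      unfolding T_def using \<beta>(1,3) by blast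
    ultimately show ?thesis by auto
  qed
  have TS: "T \<subseteq> S" by (auto simp: T_def)
  \<comment> \<open>Induction on the left end: a chain whose last interval starts further left is
    prolonged by \<open>\<alpha>\<close>.\<close>
  have chain: "\<exists>\<alpha>s. \<alpha>s \<noteq> [] \<and> set \<alpha>s \<subseteq> S \<and> successively link \<alpha>s \<and> b (hd \<alpha>s) = l \<and> last \<alpha>s = \<alpha>"
    if "\<alpha> \<in> T" for \<alpha> using that
  proof (induction "b \<alpha>" arbitrary: \<alpha> rule: less_induct)
    case less
    have \<alpha>S: "\<alpha> \<in> S" using less.prems TS by auto
    note bd = bounds[OF \<alpha>S]
    show ?case
    proof (cases "b \<alpha> = l")
      case True
      then show ?thesis using \<alpha>S by (intro exI[of _ "[\<alpha>]"]) auto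
    next
      case False
      then have bl: "l < b \<alpha>" using bd by simp
      then have "l \<le> b \<alpha> - 1" "b \<alpha> - 1 \<le> h" using bd by auto
      from T_cover[OF this] obtain \<beta> where \<beta>: "\<beta> \<in> T" "b \<beta> \<le> b \<alpha> - 1" "b \<alpha> - 1 \<le> d \<beta>"
        by blast
      have \<beta>S: "\<beta> \<in> S" using \<beta> TS by auto
      \<comment> \<open>If \<open>\<beta>\<close> ended right before \<open>\<alpha>\<close>, one
        and the same arrow would be \<open>Backward\<close> by \<open>left\<close> and
        \<open>Forward\<close> by \<open>right\<close>.\<close>
      have d\<beta>: "d \<beta> \<noteq> b \<alpha> - 1"
        using left[OF \<alpha>S bl] right[OF \<beta>S] bl bd by (cases "d \<beta> < h") auto
      have overlap: "b \<beta> < b \<alpha>" "b \<alpha> \<le> d \<beta>"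
        using \<beta> d\<beta> bl by auto
      \<comment> \<open>Otherwise \<open>\<beta>\<close> would properly contain the maximal interval
        of \<open>\<alpha>\<close>.\<close>
      have "d \<beta> < d \<alpha>"
      proof (rule ccontr)
        assume "\<not> d \<beta> < d \<alpha>"
        then have "{b \<alpha>..d \<alpha>} \<subseteq> {b \<beta>..d \<beta>}" using overlap by auto
        then have "{b \<beta>..d \<beta>} = {b \<alpha>..d \<alpha>}" using less.prems \<beta>S unfolding T_def by auto
        then show False using overlap bd bounds[OF \<beta>S] by (simp add: Icc_eq_Icc)
      qed
      then have lk: "link \<beta> \<alpha>"
        using overlap left[OF \<alpha>S bl] right[OF \<beta>S] bd unfolding link_def by auto
      obtain \<beta>s where \<beta>s: "\<beta>s \<noteq> []" "set \<beta>s \<subseteq> S" "successively link \<beta>s" "b (hd \<beta>s) = l" "last \<beta>s = \<beta>"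
        using less.hyps[OF overlap(1) \<beta>(1)] by blast
      show ?thesis
        using \<beta>s lk \<alpha>S by (intro exI[of _ "\<beta>s @ [\<alpha>]"]) (auto simp: successively_append_iff)
    qed
  qed
  obtain \<alpha> where \<alpha>: "\<alpha> \<in> T" "h \<le> d \<alpha>" using T_cover[of h] \<open>l \<le> h\<close> by auto
  have dh: "d \<alpha> = h" using \<alpha> TS bounds[of \<alpha>] by auto
  obtain \<alpha>s where \<alpha>s: "\<alpha>s \<noteq> []" "set \<alpha>s \<subseteq> S" "successively link \<alpha>s" "b (hd \<alpha>s) = l" "last \<alpha>s = \<alpha>"
    using chain[OF \<alpha>(1)] by blast
  \<comment> \<open>A chain with one member would be an interval from \<open>l\<close> to
    \<open>h\<close>, which \<open>not_full\<close> excludes.\<close>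
  have "length \<alpha>s \<noteq> 1"
  proof
    assume "length \<alpha>s = 1"
    then have "\<alpha>s = [\<alpha>]" using \<alpha>s(5) by (cases \<alpha>s) auto
    then show False using \<alpha>s not_full[of \<alpha>] dh \<alpha> TS by auto
  qed
  then have "2 \<le> length \<alpha>s" using \<alpha>s(1) by (cases \<alpha>s) (auto simp: Suc_le_eq)
  moreover have "link (\<alpha>s ! j) (\<alpha>s ! Suc j)" if "Suc j < length \<alpha>s" for j
    using successively_nth[OF \<alpha>s(3) that] .
  ultimately show thesis
    using that[of \<alpha>s] \<alpha>s dh unfolding link_def by blast
qed

text \<open>Induction from the right: a vertex to the left of the last interval is still at most the
  right end of its predecessor, because the two overlap, and so falls to the shorter chain.\<close>

lemma chain_covers:
  fixes b d :: "'a \<Rightarrow> nat"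
  assumes "\<alpha>s \<noteq> []" and "b (hd \<alpha>s) \<le> i" and "i \<le> d (last \<alpha>s)"
    and "successively (\<lambda>x y. b y \<le> d x) \<alpha>s"
  shows "\<exists>\<alpha>\<in>set \<alpha>s. b \<alpha> \<le> i \<and> i \<le> d \<alpha>"
  using assms
proof (induction \<alpha>s rule: rev_nonempty_induct)
  case (snoc \<alpha> \<alpha>s)
  then show ?case
    by (cases "b \<alpha> \<le> i") (auto simp: successively_append_iff)
qed auto

section \<open>Coordinates with respect to an interval decomposition\<close>

lemma linear_mapI:
  assumes "vectorspace K V" "vectorspace K W"
    and "\<And>x. x \<in> carrier V \<Longrightarrow> f x \<in> carrier W"
    and "\<And>x y. x \<in> carrier V \<Longrightarrow> y \<in> carrier V \<Longrightarrow> f (x \<oplus>\<^bsub>V\<^esub> y) = f x \<oplus>\<^bsub>W\<^esub> f y"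
    and "\<And>k x. k \<in> carrier K \<Longrightarrow> x \<in> carrier V \<Longrightarrow> f (k \<odot>\<^bsub>V\<^esub> x) = k \<odot>\<^bsub>W\<^esub> f x"
  shows "linear_map K V W f"
  using assms unfolding linear_map_def mod_hom_def mod_hom_axioms_def module_hom_def vectorspace_def
  by auto

lemma linear_mapD:
  assumes "linear_map K V W f"
  shows "x \<in> carrier V \<Longrightarrow> f x \<in> carrier W"
    and "x \<in> carrier V \<Longrightarrow> y \<in> carrier V \<Longrightarrow> f (x \<oplus>\<^bsub>V\<^esub> y) = f x \<oplus>\<^bsub>W\<^esub> f y"
    and "k \<in> carrier K \<Longrightarrow> x \<in> carrier V \<Longrightarrow> f (k \<odot>\<^bsub>V\<^esub> x) = k \<odot>\<^bsub>W\<^esub> f x"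
  using assms unfolding linear_map_def mod_hom_def mod_hom_axioms_def module_hom_def by auto

lemma field_module_simps [simp]:
  "carrier (field_module K) = carrier K" "\<zero>\<^bsub>field_module K\<^esub> = \<zero>\<^bsub>K\<^esub>"
  "x \<oplus>\<^bsub>field_module K\<^esub> y = x \<oplus>\<^bsub>K\<^esub> y" "x \<odot>\<^bsub>field_module K\<^esub> y = x \<otimes>\<^bsub>K\<^esub> y"
  by (auto simp: field_module_def)

lemma interval_module_simps [simp]:
  "lo (interval_module K M b d) = lo M" "hi (interval_module K M b d) = hi M"
  "dir (interval_module K M b d) = dir M"
  "src (interval_module K M b d) = src M" "tgt (interval_module K M b d) = tgt M"
  "vspace (interval_module K M b d) i =
     (if b \<le> i \<and> i \<le> d then field_module K else (field_module K)\<lparr>carrier := {\<zero>\<^bsub>K\<^esub>}\<rparr>)"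
  "smap (interval_module K M b d) i = (if b \<le> i \<and> Suc i \<le> d then (\<lambda>x. x) else (\<lambda>x. \<zero>\<^bsub>K\<^esub>))"
  by (auto simp: interval_module_def src_def tgt_def)

lemma interval_space_simps [simp]:
  "carrier (if P then field_module K else (field_module K)\<lparr>carrier := C\<rparr>) = (if P then carrier K else C)"
  "x \<oplus>\<^bsub>if P then field_module K else (field_module K)\<lparr>carrier := C\<rparr>\<^esub> y = x \<oplus>\<^bsub>K\<^esub> y"
  "x \<odot>\<^bsub>if P then field_module K else (field_module K)\<lparr>carrier := C\<rparr>\<^esub> y = x \<otimes>\<^bsub>K\<^esub> y"
  by (auto simp: field_module_def)

lemma zz_sub_simps [simp]:
  "lo (zz_sub M W) = lo M" "hi (zz_sub M W) = hi M" "src (zz_sub M W) = src M" "tgt (zz_sub M W) = tgt M"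
  "vspace (zz_sub M W) i = (vspace M i)\<lparr>carrier := W i\<rparr>" "smap (zz_sub M W) = smap M"
  by (auto simp: zz_sub_def src_def tgt_def)

lemma vectorspace_field_module:
  assumes "field K"
  shows "vectorspace K (field_module K)"
proof -
  interpret field K by fact
  show ?thesis
    using r_neg by (intro vs_criteria \<open>field K\<close>)
      (auto simp: a_ac m_assoc l_distr r_distr Bex_def)
qed

lemma linear_map_finsum:
  assumes "linear_map K V W f" "g \<in> A \<rightarrow> carrier V"
  shows "f (\<Oplus>\<^bsub>V\<^esub>a\<in>A. g a) = (\<Oplus>\<^bsub>W\<^esub>a\<in>A. f (g a))"
proof -
  interpret linear_map K V W f by fact
  show ?thesis using assms(2)
    \<comment> \<open>For infinite \<open>A\<close> both sums have the default value zero, which a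
      linear map preserves.\<close>
    by (induction A rule: infinite_finite_induct) (auto simp: Pi_iff)
qed

section \<open>Summands with chosen isomorphisms to interval modules\<close>

text \<open>The endpoints and isomorphisms, which \<open>interval_decomposition\<close> only asserts
  to exist, are fixed as parameters, so that generators and coordinates can be defined from
  them.\<close>

locale interval_decomposed =
  fixes K :: "('k, 'r) ring_scheme" and M :: "('k, 'v) zigzag"
    and A :: "'a set" and J :: "'a \<Rightarrow> nat \<Rightarrow> 'v set"
    and b d :: "'a \<Rightarrow> nat" and f :: "'a \<Rightarrow> nat \<Rightarrow> 'v \<Rightarrow> 'k"
  assumes field_K: "field K" and zigzag: "zigzag_module K M"
    and decomposition: "zz_direct_sum K M A J"
    and bounds: "\<And>\<alpha>. \<alpha> \<in> A \<Longrightarrow> lo M \<le> b \<alpha> \<and> b \<alpha> \<le> d \<alpha> \<and> d \<alpha> \<le> hi M"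
    and f_morphism: "\<And>\<alpha>. \<alpha> \<in> A \<Longrightarrow>
      zz_morphism K (zz_sub M (J \<alpha>)) (interval_module K M (b \<alpha>) (d \<alpha>)) (f \<alpha>)"
    and f_bij: "\<And>\<alpha> i. \<alpha> \<in> A \<Longrightarrow> i \<in> {lo M..hi M} \<Longrightarrow>
      bij_betw (f \<alpha> i) (J \<alpha> i) (if b \<alpha> \<le> i \<and> i \<le> d \<alpha> then carrier K else {\<zero>\<^bsub>K\<^esub>})"
begin

sublocale K: field K by (rule field_K)

abbreviation "vertices \<equiv> {lo M..hi M}"
abbreviation "edges \<equiv> {lo M..<hi M}"
abbreviation "V \<equiv> vspace M"

lemma finite_A: "finite A"
  using decomposition by (simp add: zz_direct_sum_def)

lemma edge_ends:
  assumes "i \<in> edges"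
  shows "src M i \<in> vertices" "tgt M i \<in> vertices"
  using assms by (auto simp: src_def tgt_def split: arrow.split)

lemma vectorspace_V: "i \<in> vertices \<Longrightarrow> vectorspace K (V i)"
  using zigzag by (simp add: zigzag_module_def)

lemma module_V: "i \<in> vertices \<Longrightarrow> module K (V i)"
  using vectorspace_V by (simp add: vectorspace_def)

lemma smap_linear: "i \<in> edges \<Longrightarrow> linear_map K (V (src M i)) (V (tgt M i)) (smap M i)"
  using zigzag by (simp add: zigzag_module_def)

lemma J_submodule: "\<alpha> \<in> A \<Longrightarrow> i \<in> vertices \<Longrightarrow> submodule K (J \<alpha> i) (V i)"
  using decomposition by (simp add: zz_direct_sum_def zz_submodule_def subspace_def)

lemma J_closed:
  assumes "\<alpha> \<in> A" "i \<in> vertices"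
  shows "x \<in> J \<alpha> i \<Longrightarrow> x \<in> carrier (V i)"
    and "\<zero>\<^bsub>V i\<^esub> \<in> J \<alpha> i"
    and "x \<in> J \<alpha> i \<Longrightarrow> y \<in> J \<alpha> i \<Longrightarrow> x \<oplus>\<^bsub>V i\<^esub> y \<in> J \<alpha> i"
    and "k \<in> carrier K \<Longrightarrow> x \<in> J \<alpha> i \<Longrightarrow> k \<odot>\<^bsub>V i\<^esub> x \<in> J \<alpha> i"
  using submodule.subset[OF J_submodule[OF assms]] submodule.zero_closed[OF J_submodule[OF assms]]
    submodule.m_closed[OF J_submodule[OF assms]] submodule.smult_closed[OF J_submodule[OF assms]]
  by auto

lemma J_smap: "\<alpha> \<in> A \<Longrightarrow> i \<in> edges \<Longrightarrow> x \<in> J \<alpha> (src M i) \<Longrightarrow> smap M i x \<in> J \<alpha> (tgt M i)"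
  using decomposition by (fastforce simp: zz_direct_sum_def zz_submodule_def)

lemma f_linear:
  assumes "\<alpha> \<in> A" "i \<in> vertices"
  shows "x \<in> J \<alpha> i \<Longrightarrow> f \<alpha> i x \<in> carrier K"
    and "x \<in> J \<alpha> i \<Longrightarrow> y \<in> J \<alpha> i \<Longrightarrow> f \<alpha> i (x \<oplus>\<^bsub>V i\<^esub> y) = f \<alpha> i x \<oplus>\<^bsub>K\<^esub> f \<alpha> i y"
    and "k \<in> carrier K \<Longrightarrow> x \<in> J \<alpha> i \<Longrightarrow> f \<alpha> i (k \<odot>\<^bsub>V i\<^esub> x) = k \<otimes>\<^bsub>K\<^esub> f \<alpha> i x"
proof -
  have "linear_map K ((V i)\<lparr>carrier := J \<alpha> i\<rparr>) (vspace (interval_module K M (b \<alpha>) (d \<alpha>)) i) (f \<alpha> i)"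
    using f_morphism[OF assms(1)] assms(2) unfolding zz_morphism_def by (simp del: interval_module_simps(6))
  note linear = linear_mapD[OF this]
  show "x \<in> J \<alpha> i \<Longrightarrow> f \<alpha> i x \<in> carrier K"
    and "x \<in> J \<alpha> i \<Longrightarrow> y \<in> J \<alpha> i \<Longrightarrow> f \<alpha> i (x \<oplus>\<^bsub>V i\<^esub> y) = f \<alpha> i x \<oplus>\<^bsub>K\<^esub> f \<alpha> i y"
    and "k \<in> carrier K \<Longrightarrow> x \<in> J \<alpha> i \<Longrightarrow> f \<alpha> i (k \<odot>\<^bsub>V i\<^esub> x) = k \<otimes>\<^bsub>K\<^esub> f \<alpha> i x"
    using linear(1)[of x] linear(2,3) by (cases "b \<alpha> \<le> i \<and> i \<le> d \<alpha>"; simp)+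
qed

lemma f_outside: "\<alpha> \<in> A \<Longrightarrow> i \<in> vertices \<Longrightarrow> \<not> (b \<alpha> \<le> i \<and> i \<le> d \<alpha>) \<Longrightarrow> x \<in> J \<alpha> i \<Longrightarrow> f \<alpha> i x = \<zero>\<^bsub>K\<^esub>"
  using f_bij[of \<alpha> i] unfolding bij_betw_def by auto

lemma f_zero:
  assumes "\<alpha> \<in> A" "i \<in> vertices"
  shows "f \<alpha> i \<zero>\<^bsub>V i\<^esub> = \<zero>\<^bsub>K\<^esub>"
proof -
  interpret Vi: module K "V i" using module_V assms by blast
  have "f \<alpha> i (\<zero>\<^bsub>K\<^esub> \<odot>\<^bsub>V i\<^esub> \<zero>\<^bsub>V i\<^esub>) = \<zero>\<^bsub>K\<^esub> \<otimes>\<^bsub>K\<^esub> f \<alpha> i \<zero>\<^bsub>V i\<^esub>"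
    by (rule f_linear(3)[OF assms K.zero_closed J_closed(2)[OF assms]])
  then show ?thesis using f_linear(1)[OF assms J_closed(2)[OF assms]] by simp
qed

lemma f_inj: "\<alpha> \<in> A \<Longrightarrow> i \<in> vertices \<Longrightarrow> x \<in> J \<alpha> i \<Longrightarrow> y \<in> J \<alpha> i \<Longrightarrow> f \<alpha> i x = f \<alpha> i y \<Longrightarrow> x = y"
  using f_bij[of \<alpha> i] unfolding bij_betw_def inj_on_def by blast

lemma f_smap:
  assumes "\<alpha> \<in> A" "i \<in> edges" "x \<in> J \<alpha> (src M i)"
  shows "f \<alpha> (tgt M i) (smap M i x) = (if b \<alpha> \<le> i \<and> Suc i \<le> d \<alpha> then f \<alpha> (src M i) x else \<zero>\<^bsub>K\<^esub>)"
  using f_morphism[OF assms(1)] assms(2,3) unfolding zz_morphism_def by simp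

section \<open>Generators of the summands\<close>

text \<open>A basis vector of the line \<open>J \<alpha> i\<close> inside the interval; outside it
  the zero vector, so that the family is defined at every vertex.\<close>

definition gen :: "'a \<Rightarrow> nat \<Rightarrow> 'v" where
  "gen \<alpha> i = inv_into (J \<alpha> i) (f \<alpha> i) (if b \<alpha> \<le> i \<and> i \<le> d \<alpha> then \<one>\<^bsub>K\<^esub> else \<zero>\<^bsub>K\<^esub>)"

lemma gen:
  assumes "\<alpha> \<in> A" "i \<in> vertices"
  shows gen_in: "gen \<alpha> i \<in> J \<alpha> i"
    and f_gen: "f \<alpha> i (gen \<alpha> i) = (if b \<alpha> \<le> i \<and> i \<le> d \<alpha> then \<one>\<^bsub>K\<^esub> else \<zero>\<^bsub>K\<^esub>)"
proof -
  have "(if b \<alpha> \<le> i \<and> i \<le> d \<alpha> then \<one>\<^bsub>K\<^esub> else \<zero>\<^bsub>K\<^esub>) \<in> f \<alpha> i ` J \<alpha> i"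
    using f_bij[OF assms] unfolding bij_betw_def by auto
  then show "gen \<alpha> i \<in> J \<alpha> i" "f \<alpha> i (gen \<alpha> i) = (if b \<alpha> \<le> i \<and> i \<le> d \<alpha> then \<one>\<^bsub>K\<^esub> else \<zero>\<^bsub>K\<^esub>)"
    unfolding gen_def by (rule inv_into_into, rule f_inv_into_f)
qed

lemma gen_outside: "\<alpha> \<in> A \<Longrightarrow> i \<in> vertices \<Longrightarrow> \<not> (b \<alpha> \<le> i \<and> i \<le> d \<alpha>) \<Longrightarrow> gen \<alpha> i = \<zero>\<^bsub>V i\<^esub>"
  using f_inj[of \<alpha> i] gen[of \<alpha> i] J_closed(2) f_zero by auto

text \<open>Both sides lie in \<open>J \<alpha>\<close> at the target, so comparing their values
  under the injective \<open>f\<close> suffices. The last hypothesis excludes an arrow that enters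
  the interval from outside, the only case in which the generator at the target is not hit.\<close>

lemma gen_smap:
  assumes "\<alpha> \<in> A" "i \<in> edges"
    and "b \<alpha> \<le> tgt M i \<and> tgt M i \<le> d \<alpha> \<Longrightarrow> b \<alpha> \<le> src M i \<and> src M i \<le> d \<alpha>"
  shows "smap M i (gen \<alpha> (src M i)) = gen \<alpha> (tgt M i)"
proof (rule f_inj)
  note e = edge_ends[OF assms(2)]
  show "\<alpha> \<in> A" "tgt M i \<in> vertices" using assms e by auto
  show "smap M i (gen \<alpha> (src M i)) \<in> J \<alpha> (tgt M i)" using J_smap gen e assms by blast
  show "gen \<alpha> (tgt M i) \<in> J \<alpha> (tgt M i)" using gen e assms by blast
  show "f \<alpha> (tgt M i) (smap M i (gen \<alpha> (src M i))) = f \<alpha> (tgt M i) (gen \<alpha> (tgt M i))"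
    unfolding f_smap[OF assms(1,2) gen_in[OF assms(1) e(1)]] f_gen[OF assms(1) e(1)] f_gen[OF assms(1) e(2)]
    using assms(3) by (auto simp: src_def tgt_def split: arrow.splits)
qed

text \<open>Both sides have the same value under the injective \<open>f\<close>: inside the interval
  the generator has value one, outside every value is zero.\<close>

lemma eq_smult_gen:
  assumes "\<alpha> \<in> A" "i \<in> vertices" "x \<in> J \<alpha> i"
  shows "x = f \<alpha> i x \<odot>\<^bsub>V i\<^esub> gen \<alpha> i"
proof (rule f_inj[OF assms])
  note k = f_linear(1)[OF assms]
  show "f \<alpha> i x \<odot>\<^bsub>V i\<^esub> gen \<alpha> i \<in> J \<alpha> i"
    using J_closed(4) gen assms k by blast
  show "f \<alpha> i x = f \<alpha> i (f \<alpha> i x \<odot>\<^bsub>V i\<^esub> gen \<alpha> i)"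
    using f_linear(3)[OF assms(1,2) k gen_in] f_gen f_outside assms k by auto
qed

section \<open>Components and coordinates of a vector\<close>

definition component :: "nat \<Rightarrow> 'v \<Rightarrow> 'a \<Rightarrow> 'v" where
  "component i x = (THE w. w \<in> (\<Pi>\<^sub>E \<alpha>\<in>A. J \<alpha> i) \<and> x = (\<Oplus>\<^bsub>V i\<^esub>\<alpha>\<in>A. w \<alpha>))"

lemma component:
  assumes "i \<in> vertices" "x \<in> carrier (V i)"
  shows component_in: "\<alpha> \<in> A \<Longrightarrow> component i x \<alpha> \<in> J \<alpha> i"
    and component_sum: "(\<Oplus>\<^bsub>V i\<^esub>\<alpha>\<in>A. component i x \<alpha>) = x"
    and component_unique: "(\<And>\<alpha>. \<alpha> \<in> A \<Longrightarrow> w \<alpha> \<in> J \<alpha> i) \<Longrightarrow> x = (\<Oplus>\<^bsub>V i\<^esub>\<alpha>\<in>A. w \<alpha>) \<Longrightarrow>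
      \<alpha> \<in> A \<Longrightarrow> component i x \<alpha> = w \<alpha>"
proof -
  interpret Vi: module K "V i" using module_V assms by blast
  have ex1: "\<exists>!w. w \<in> (\<Pi>\<^sub>E \<alpha>\<in>A. J \<alpha> i) \<and> x = (\<Oplus>\<^bsub>V i\<^esub>\<alpha>\<in>A. w \<alpha>)"
    using decomposition assms by (auto simp: zz_direct_sum_def)
  note the = theI'[OF ex1, folded component_def]
  show "\<alpha> \<in> A \<Longrightarrow> component i x \<alpha> \<in> J \<alpha> i" "(\<Oplus>\<^bsub>V i\<^esub>\<alpha>\<in>A. component i x \<alpha>) = x"
    using the by auto
  show "component i x \<alpha> = w \<alpha>" if w: "\<And>\<alpha>. \<alpha> \<in> A \<Longrightarrow> w \<alpha> \<in> J \<alpha> i" "x = (\<Oplus>\<^bsub>V i\<^esub>\<alpha>\<in>A. w \<alpha>)" and \<alpha>: "\<alpha> \<in> A"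
  proof -
    \<comment> \<open>Uniqueness in \<open>zz_direct_sum\<close> concerns families that are
      \<open>undefined\<close> outside \<open>A\<close>, so \<open>w\<close> is first restricted to
      \<open>A\<close>.\<close>
    have "(\<Oplus>\<^bsub>V i\<^esub>\<alpha>\<in>A. restrict w A \<alpha>) = (\<Oplus>\<^bsub>V i\<^esub>\<alpha>\<in>A. w \<alpha>)"
      using w J_closed assms by (intro Vi.finsum_cong') auto
    then have "component i x = restrict w A"
      unfolding component_def using w by (intro the1_equality[OF ex1]) (auto simp: restrict_PiE_iff)
    then show ?thesis using \<alpha> by simp
  qed
qed

text \<open>For fixed \<open>\<alpha>\<close> these functionals form the projection of the module
  onto the summand \<open>J \<alpha>\<close>, read in its interval module.\<close>

definition coord :: "'a \<Rightarrow> nat \<Rightarrow> 'v \<Rightarrow> 'k" where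
  "coord \<alpha> i x = f \<alpha> i (component i x \<alpha>)"

lemma coord_closed: "\<alpha> \<in> A \<Longrightarrow> i \<in> vertices \<Longrightarrow> x \<in> carrier (V i) \<Longrightarrow> coord \<alpha> i x \<in> carrier K"
  unfolding coord_def by (simp add: component_in f_linear(1))

lemma coord_outside:
  "\<alpha> \<in> A \<Longrightarrow> i \<in> vertices \<Longrightarrow> x \<in> carrier (V i) \<Longrightarrow> \<not> (b \<alpha> \<le> i \<and> i \<le> d \<alpha>) \<Longrightarrow> coord \<alpha> i x = \<zero>\<^bsub>K\<^esub>"
  unfolding coord_def by (simp add: component_in f_outside)

lemma coord_add:
  assumes "\<alpha> \<in> A" "i \<in> vertices" "x \<in> carrier (V i)" "y \<in> carrier (V i)"
  shows "coord \<alpha> i (x \<oplus>\<^bsub>V i\<^esub> y) = coord \<alpha> i x \<oplus>\<^bsub>K\<^esub> coord \<alpha> i y"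
proof -
  interpret Vi: module K "V i" using module_V assms by blast
  have "component i (x \<oplus>\<^bsub>V i\<^esub> y) \<alpha> = component i x \<alpha> \<oplus>\<^bsub>V i\<^esub> component i y \<alpha>"
  proof (rule component_unique)
    show "x \<oplus>\<^bsub>V i\<^esub> y = (\<Oplus>\<^bsub>V i\<^esub>\<alpha>\<in>A. component i x \<alpha> \<oplus>\<^bsub>V i\<^esub> component i y \<alpha>)"
      using component_in J_closed(1) component_sum assms by (subst Vi.finsum_addf) auto
  qed (use assms J_closed component_in in auto)
  then show ?thesis unfolding coord_def using assms component_in f_linear(2) by simp
qed

lemma coord_smult:
  assumes "\<alpha> \<in> A" "i \<in> vertices" "x \<in> carrier (V i)" "k \<in> carrier K"
  shows "coord \<alpha> i (k \<odot>\<^bsub>V i\<^esub> x) = k \<otimes>\<^bsub>K\<^esub> coord \<alpha> i x"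
proof -
  interpret Vi: module K "V i" using module_V assms by blast
  have "component i (k \<odot>\<^bsub>V i\<^esub> x) \<alpha> = k \<odot>\<^bsub>V i\<^esub> component i x \<alpha>"
  proof (rule component_unique)
    show "k \<odot>\<^bsub>V i\<^esub> x = (\<Oplus>\<^bsub>V i\<^esub>\<alpha>\<in>A. k \<odot>\<^bsub>V i\<^esub> component i x \<alpha>)"
      using component_in J_closed(1) component_sum assms finite_A by (subst Vi.finsum_smult_ldistr[symmetric]) auto
  qed (use assms J_closed component_in in auto)
  then show ?thesis unfolding coord_def using assms component_in f_linear(3) by simp
qed

lemma coord_linear:
  assumes "\<alpha> \<in> A" "i \<in> vertices"
  shows "linear_map K (V i) (field_module K) (coord \<alpha> i)"
  using assms by (intro linear_mapI)
    (simp_all add: vectorspace_V vectorspace_field_module field_K coord_closed coord_add coord_smult)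

text \<open>Structure maps preserve each summand, so by uniqueness the components of the image are
  the images of the components. Thus \<open>coord \<alpha>\<close> is a morphism to the interval
  module.\<close>

lemma coord_smap:
  assumes "\<alpha> \<in> A" "i \<in> edges" "x \<in> carrier (V (src M i))"
  shows "coord \<alpha> (tgt M i) (smap M i x) =
    (if b \<alpha> \<le> i \<and> Suc i \<le> d \<alpha> then coord \<alpha> (src M i) x else \<zero>\<^bsub>K\<^esub>)"
proof -
  note e = edge_ends[OF assms(2)]
  have "component (tgt M i) (smap M i x) \<alpha> = smap M i (component (src M i) x \<alpha>)"
  proof (rule component_unique)
    have "component (src M i) x \<in> A \<rightarrow> carrier (V (src M i))"
      using component_in J_closed(1) e assms by auto
    then have "smap M i (\<Oplus>\<^bsub>V (src M i)\<^esub>\<alpha>\<in>A. component (src M i) x \<alpha>) =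
        (\<Oplus>\<^bsub>V (tgt M i)\<^esub>\<alpha>\<in>A. smap M i (component (src M i) x \<alpha>))"
      by (rule linear_map_finsum[OF smap_linear[OF assms(2)]])
    then show "smap M i x = (\<Oplus>\<^bsub>V (tgt M i)\<^esub>\<alpha>\<in>A. smap M i (component (src M i) x \<alpha>))"
      using component_sum e assms by simp
  qed (use assms e J_smap component_in linear_mapD(1)[OF smap_linear] in auto)
  then show ?thesis unfolding coord_def using assms e component_in f_smap by simp
qed

text \<open>If all coordinates vanish, injectivity of \<open>f\<close> makes every component zero,
  and \<open>x\<close> is their sum.\<close>

lemma ex_coord_nonzero:
  assumes "i \<in> vertices" "x \<in> carrier (V i)" "x \<noteq> \<zero>\<^bsub>V i\<^esub>"
  shows "\<exists>\<alpha>\<in>A. coord \<alpha> i x \<noteq> \<zero>\<^bsub>K\<^esub>"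
proof (rule ccontr)
  interpret Vi: module K "V i" using module_V assms by blast
  assume "\<not> ?thesis"
  then have "component i x \<alpha> = \<zero>\<^bsub>V i\<^esub>" if "\<alpha> \<in> A" for \<alpha>
    using that assms component_in J_closed(2) f_zero f_inj unfolding coord_def by metis
  then have "(\<Oplus>\<^bsub>V i\<^esub>\<alpha>\<in>A. component i x \<alpha>) = (\<Oplus>\<^bsub>V i\<^esub>\<alpha>\<in>A. \<zero>\<^bsub>V i\<^esub>)"
    by (intro Vi.finsum_cong') auto
  then show False using assms component_sum by simp
qed

end

section \<open>Threads and the lines they span\<close>

text \<open>The functional \<open>r\<close> reads off the coefficient of \<open>v\<close> in the
  splitting of a vector along the line and \<open>U\<close>; applied at each vertex, it turns a
  complement into a retraction.\<close>

lemma projection_onto_line: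
  assumes "vectorspace K V" and v: "v \<in> carrier V" "v \<noteq> \<zero>\<^bsub>V\<^esub>" and U: "subspace K U V"
    and sum: "((\<lambda>k. k \<odot>\<^bsub>V\<^esub> v) ` carrier K) <+>\<^bsub>V\<^esub> U = carrier V"
    and int: "((\<lambda>k. k \<odot>\<^bsub>V\<^esub> v) ` carrier K) \<inter> U = {\<zero>\<^bsub>V\<^esub>}"
  obtains r where "linear_map K V (field_module K) r" "r v = \<one>\<^bsub>K\<^esub>" "\<And>u. u \<in> U \<Longrightarrow> r u = \<zero>\<^bsub>K\<^esub>"
    "\<And>x. x \<in> carrier V \<Longrightarrow> \<exists>u\<in>U. x = r x \<odot>\<^bsub>V\<^esub> v \<oplus>\<^bsub>V\<^esub> u"
proof -
  interpret vectorspace K V by fact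
  interpret U: LinearCombinations.submodule K U V using U by (simp add: subspace_def)
  have U_carrier: "u \<in> carrier V" if "u \<in> U" for u using U.subset that by auto
  \<comment> \<open>Subtracting two expressions of one vector gives a multiple of \<open>v\<close>
    that also lies in \<open>U\<close>, hence is zero.\<close>
  have unique: "k = k' \<and> u = u'" if eq: "k \<odot>\<^bsub>V\<^esub> v \<oplus>\<^bsub>V\<^esub> u = k' \<odot>\<^bsub>V\<^esub> v \<oplus>\<^bsub>V\<^esub> u'"
    and k: "k \<in> carrier K" "k' \<in> carrier K" and u: "u \<in> U" "u' \<in> U" for k k' u u'
  proof -
    have minus: "\<ominus>\<^bsub>V\<^esub> u = (\<ominus>\<^bsub>K\<^esub> \<one>\<^bsub>K\<^esub>) \<odot>\<^bsub>V\<^esub> u"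
      using U_carrier u by (simp add: smult_l_minus)
    then have "u' \<oplus>\<^bsub>V\<^esub> \<ominus>\<^bsub>V\<^esub> u \<in> U" using u by simp
    moreover have "(k \<oplus>\<^bsub>K\<^esub> \<ominus>\<^bsub>K\<^esub> k') \<odot>\<^bsub>V\<^esub> v = u' \<oplus>\<^bsub>V\<^esub> \<ominus>\<^bsub>V\<^esub> u"
    proof -
      have "(k \<oplus>\<^bsub>K\<^esub> \<ominus>\<^bsub>K\<^esub> k') \<odot>\<^bsub>V\<^esub> v = k \<odot>\<^bsub>V\<^esub> v \<oplus>\<^bsub>V\<^esub> \<ominus>\<^bsub>V\<^esub> (k' \<odot>\<^bsub>V\<^esub> v)"
        using k v by (simp add: smult_l_distr smult_l_minus)
      also have "k \<odot>\<^bsub>V\<^esub> v = (k' \<odot>\<^bsub>V\<^esub> v \<oplus>\<^bsub>V\<^esub> u') \<oplus>\<^bsub>V\<^esub> \<ominus>\<^bsub>V\<^esub> u"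
        unfolding eq[symmetric] using k v u U_carrier by (simp add: M.a_assoc M.r_neg)
      also have "\<dots> \<oplus>\<^bsub>V\<^esub> \<ominus>\<^bsub>V\<^esub> (k' \<odot>\<^bsub>V\<^esub> v) = u' \<oplus>\<^bsub>V\<^esub> \<ominus>\<^bsub>V\<^esub> u"
        using k v u U_carrier by (simp add: M.a_ac M.r_neg M.r_neg1)
      finally show ?thesis .
    qed
    moreover have "(k \<oplus>\<^bsub>K\<^esub> \<ominus>\<^bsub>K\<^esub> k') \<odot>\<^bsub>V\<^esub> v \<in> (\<lambda>k. k \<odot>\<^bsub>V\<^esub> v) ` carrier K"
      by (rule imageI) (use k in simp)
    ultimately have "(k \<oplus>\<^bsub>K\<^esub> \<ominus>\<^bsub>K\<^esub> k') \<odot>\<^bsub>V\<^esub> v \<in> ((\<lambda>k. k \<odot>\<^bsub>V\<^esub> v) ` carrier K) \<inter> U"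
      by simp
    then have "(k \<oplus>\<^bsub>K\<^esub> \<ominus>\<^bsub>K\<^esub> k') \<odot>\<^bsub>V\<^esub> v = \<zero>\<^bsub>V\<^esub>" using int by simp
    \<comment> \<open>A nonzero scalar could be inverted, which would make \<open>v\<close>
      zero.\<close>
    then have "k \<oplus>\<^bsub>K\<^esub> \<ominus>\<^bsub>K\<^esub> k' = \<zero>\<^bsub>K\<^esub>"
      using mult_inverse[of "k \<oplus>\<^bsub>K\<^esub> \<ominus>\<^bsub>K\<^esub> k'" v "\<zero>\<^bsub>V\<^esub>"] k v
        Units_inv_closed[of "k \<oplus>\<^bsub>K\<^esub> \<ominus>\<^bsub>K\<^esub> k'"] by (cases "k \<oplus>\<^bsub>K\<^esub> \<ominus>\<^bsub>K\<^esub> k' = \<zero>\<^bsub>K\<^esub>") (auto simp: field_Units)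
    then have "k = k'" using k R.add.inv_equality[of k "\<ominus>\<^bsub>K\<^esub> k'"] by (simp add: a_inv_def[symmetric])
    moreover from this have "u = u'" using eq k v u U_carrier by simp
    ultimately show ?thesis by simp
  qed
  define r where "r x = (THE k. k \<in> carrier K \<and> (\<exists>u\<in>U. x = k \<odot>\<^bsub>V\<^esub> v \<oplus>\<^bsub>V\<^esub> u))" for x
  have r_eq: "r (k \<odot>\<^bsub>V\<^esub> v \<oplus>\<^bsub>V\<^esub> u) = k" if "k \<in> carrier K" "u \<in> U" for k u
    unfolding r_def using that unique by (intro the_equality) blast+
  have decomp: "\<exists>u\<in>U. \<exists>k\<in>carrier K. x = k \<odot>\<^bsub>V\<^esub> v \<oplus>\<^bsub>V\<^esub> u" if "x \<in> carrier V" for x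
    using that unfolding sum[symmetric] set_add_def' by auto
  show thesis
  proof (rule that)
    show "linear_map K V (field_module K) r"
    proof (rule linear_mapI)
      show "vectorspace K (field_module K)" by (rule vectorspace_field_module) (rule field_axioms)
      show "r x \<in> carrier (field_module K)" if "x \<in> carrier V" for x
        using decomp[OF that] r_eq by auto
    next
      fix x y assume "x \<in> carrier V" "y \<in> carrier V"
      then obtain k u k' u' where x: "x = k \<odot>\<^bsub>V\<^esub> v \<oplus>\<^bsub>V\<^esub> u" "k \<in> carrier K" "u \<in> U"
        and y: "y = k' \<odot>\<^bsub>V\<^esub> v \<oplus>\<^bsub>V\<^esub> u'" "k' \<in> carrier K" "u' \<in> U"
        using decomp by metis
      then have "x \<oplus>\<^bsub>V\<^esub> y = (k \<oplus>\<^bsub>K\<^esub> k') \<odot>\<^bsub>V\<^esub> v \<oplus>\<^bsub>V\<^esub> (u \<oplus>\<^bsub>V\<^esub> u')"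
        using v U_carrier by (simp add: smult_l_distr M.a_ac)
      then show "r (x \<oplus>\<^bsub>V\<^esub> y) = r x \<oplus>\<^bsub>field_module K\<^esub> r y"
        using x y r_eq by simp
    next
      fix l x assume l: "l \<in> carrier K" "x \<in> carrier V"
      then obtain k u where x: "x = k \<odot>\<^bsub>V\<^esub> v \<oplus>\<^bsub>V\<^esub> u" "k \<in> carrier K" "u \<in> U"
        using decomp by metis
      then have "l \<odot>\<^bsub>V\<^esub> x = (l \<otimes>\<^bsub>K\<^esub> k) \<odot>\<^bsub>V\<^esub> v \<oplus>\<^bsub>V\<^esub> (l \<odot>\<^bsub>V\<^esub> u)"
        using v l U_carrier by (simp add: smult_r_distr smult_assoc1)
      then show "r (l \<odot>\<^bsub>V\<^esub> x) = l \<odot>\<^bsub>field_module K\<^esub> r x"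
        using x l r_eq by simp
    qed fact
    show "r v = \<one>\<^bsub>K\<^esub>" using r_eq[of "\<one>\<^bsub>K\<^esub>" "\<zero>\<^bsub>V\<^esub>"] v by simp
    show "r u = \<zero>\<^bsub>K\<^esub>" if "u \<in> U" for u using r_eq[of "\<zero>\<^bsub>K\<^esub>" u] v that U_carrier by simp
    show "\<exists>u\<in>U. x = r x \<odot>\<^bsub>V\<^esub> v \<oplus>\<^bsub>V\<^esub> u" if "x \<in> carrier V" for x
      using decomp[OF that] r_eq by auto
  qed
qed

section \<open>Endpoints of an interval summand are determined\<close>

text \<open>Cardinality is preserved by isomorphism and tells \<open>K\<close> from the zero space.
  The test also works for infinite \<open>K\<close>, where \<open>card\<close> takes the default
  value 0.\<close>

lemma interval_summand_support:
  assumes "field K" "interval_summand K M W b d" "i \<in> {lo M..hi M}"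
  shows "card (W i) \<noteq> 1 \<longleftrightarrow> b \<le> i \<and> i \<le> d"
proof -
  interpret field K by fact
  obtain f where "\<forall>i\<in>{lo M..hi M}.
      bij_betw (f i) (W i) (if b \<le> i \<and> i \<le> d then carrier K else {\<zero>\<^bsub>K\<^esub>})"
    using assms(2) unfolding interval_summand_def zz_isomorphic_def zz_sub_simps interval_module_simps
      interval_space_simps by auto
  then have "bij_betw (f i) (W i) (if b \<le> i \<and> i \<le> d then carrier K else {\<zero>\<^bsub>K\<^esub>})"
    using assms(3) by blast
  then have "card (W i) = card (if b \<le> i \<and> i \<le> d then carrier K else {\<zero>\<^bsub>K\<^esub>})"
    by (rule bij_betw_same_card)
  moreover have "card (carrier K) \<noteq> 1"
    using one_not_zero by (metis card_1_singletonE one_closed singletonD zero_closed)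
  ultimately show ?thesis by auto
qed

text \<open>The vertices where \<open>W\<close> is nonzero form both intervals, and a nonempty
  interval determines its ends.\<close>

lemma interval_summand_unique:
  assumes "field K" "interval_summand K M W b d" "interval_summand K M W b' d'"
  shows "b = b' \<and> d = d'"
proof -
  have "i \<in> {b..d} \<longleftrightarrow> i \<in> {b'..d'}" for i
    using interval_summand_support[OF assms(1,2), of i] interval_summand_support[OF assms(1,3), of i]
      assms(2,3) by (auto simp: interval_summand_def)
  then have "{b..d} = {b'..d'}" by blast
  then show ?thesis using assms(2) by (auto simp: Icc_eq_Icc interval_summand_def)
qed

context interval_decomposed
begin

text \<open>Replaces the existentially quantified endpoints in \<open>breaker_pair\<close> and
  \<open>chain_spans\<close> by the fixed \<open>b\<close> and \<open>d\<close>.\<close>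

lemma interval_summand_iff:
  assumes "\<alpha> \<in> A"
  shows "interval_summand K M (J \<alpha>) b' d' \<longleftrightarrow> b' = b \<alpha> \<and> d' = d \<alpha>"
proof -
  have "interval_summand K M (J \<alpha>) (b \<alpha>) (d \<alpha>)"
    unfolding interval_summand_def zz_isomorphic_def
    using bounds[OF assms] f_morphism[OF assms] f_bij[OF assms]
    by (intro conjI exI[of _ "f \<alpha>"]) (auto simp del: if_split split del: if_split)
  then show ?thesis using interval_summand_unique field_K by metis
qed

text \<open>Threads correspond to the morphisms from the interval module with full support: a morphism
  \<open>\<iota>\<close> is determined by the images \<open>\<iota>\<^sub>i(1)\<close>, which form a thread.\<close>

definition thread :: "(nat \<Rightarrow> 'v) \<Rightarrow> bool" where
  "thread v \<longleftrightarrow> (\<forall>i\<in>vertices. v i \<in> carrier (V i)) \<and> (\<forall>i\<in>edges. smap M i (v (src M i)) = v (tgt M i))"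

abbreviation line :: "(nat \<Rightarrow> 'v) \<Rightarrow> nat \<Rightarrow> 'v set" where
  "line v i \<equiv> (\<lambda>k. k \<odot>\<^bsub>V i\<^esub> v i) ` carrier K"

text \<open>By linearity \<open>\<iota> i k\<close> is the multiple of
  \<open>\<iota> i \<one>\<close> by \<open>k\<close>. Hence the image is a line, and injectivity
  keeps the image of one away from zero.\<close>

lemma zz_monomorphism_thread:
  assumes "zz_monomorphism K (interval_module K M (lo M) (hi M)) M \<iota>"
  shows "thread (\<lambda>i. \<iota> i \<one>\<^bsub>K\<^esub>)"
    and "i \<in> vertices \<Longrightarrow> \<iota> i \<one>\<^bsub>K\<^esub> \<noteq> \<zero>\<^bsub>V i\<^esub>"
    and "i \<in> vertices \<Longrightarrow> zz_image (interval_module K M (lo M) (hi M)) \<iota> i = line (\<lambda>i. \<iota> i \<one>\<^bsub>K\<^esub>) i"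
proof -
  have linear: "linear_map K (field_module K) (V i) (\<iota> i)" if "i \<in> vertices" for i
    using assms that by (auto simp: zz_monomorphism_def zz_morphism_def)
  have inj: "inj_on (\<iota> i) (carrier K)" if "i \<in> vertices" for i
    using assms that by (auto simp: zz_monomorphism_def)
  have smap: "\<iota> (tgt M i) \<one>\<^bsub>K\<^esub> = smap M i (\<iota> (src M i) \<one>\<^bsub>K\<^esub>)" if "i \<in> edges" for i
  proof -
    have "\<forall>x\<in>carrier (vspace (interval_module K M (lo M) (hi M)) (src M i)).
        \<iota> (tgt M i) (smap (interval_module K M (lo M) (hi M)) i x) = smap M i (\<iota> (src M i) x)"
      using assms that unfolding zz_monomorphism_def zz_morphism_def
      by (simp del: interval_module_simps(6,7))
    from bspec[OF this, of "\<one>\<^bsub>K\<^esub>"] show ?thesis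
      using edge_ends[OF that] that by simp
  qed
  show "thread (\<lambda>i. \<iota> i \<one>\<^bsub>K\<^esub>)"
    unfolding thread_def using linear_mapD(1)[OF linear] smap by auto
  have smult: "\<iota> i k = k \<odot>\<^bsub>V i\<^esub> \<iota> i \<one>\<^bsub>K\<^esub>" if "i \<in> vertices" "k \<in> carrier K" for i k
    using linear_mapD(3)[OF linear, of i k "\<one>\<^bsub>K\<^esub>"] that by simp
  show "\<iota> i \<one>\<^bsub>K\<^esub> \<noteq> \<zero>\<^bsub>V i\<^esub>" if i: "i \<in> vertices"
  proof
    interpret Vi: module K "V i" using module_V i by blast
    assume "\<iota> i \<one>\<^bsub>K\<^esub> = \<zero>\<^bsub>V i\<^esub>"
    then have "\<iota> i \<zero>\<^bsub>K\<^esub> = \<iota> i \<one>\<^bsub>K\<^esub>" using smult[OF i K.zero_closed] by simp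
    then show False using inj_onD[OF inj[OF i], of "\<zero>\<^bsub>K\<^esub>" "\<one>\<^bsub>K\<^esub>"] K.one_not_zero by simp
  qed
  show "zz_image (interval_module K M (lo M) (hi M)) \<iota> i = line (\<lambda>i. \<iota> i \<one>\<^bsub>K\<^esub>) i" if "i \<in> vertices"
    unfolding zz_image_def using that by (intro image_cong smult) auto
qed

text \<open>Some coordinate of \<open>x\<close> is nonzero and can be cancelled in
  \<open>K\<close>.\<close>

lemma smult_inj_on:
  assumes "i \<in> vertices" "x \<in> carrier (V i)" "x \<noteq> \<zero>\<^bsub>V i\<^esub>"
  shows "inj_on (\<lambda>k. k \<odot>\<^bsub>V i\<^esub> x) (carrier K)"
proof (rule inj_onI)
  fix k l assume kl: "k \<in> carrier K" "l \<in> carrier K" "k \<odot>\<^bsub>V i\<^esub> x = l \<odot>\<^bsub>V i\<^esub> x"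
  obtain \<alpha> where \<alpha>: "\<alpha> \<in> A" "coord \<alpha> i x \<noteq> \<zero>\<^bsub>K\<^esub>" using ex_coord_nonzero assms by blast
  have "k \<otimes>\<^bsub>K\<^esub> coord \<alpha> i x = l \<otimes>\<^bsub>K\<^esub> coord \<alpha> i x"
    using kl \<alpha> assms by (metis coord_smult)
  then show "k = l" using K.m_rcancel coord_closed \<alpha> assms kl by auto
qed

lemma thread_zz_monomorphism:
  assumes v: "thread v" "\<And>i. i \<in> vertices \<Longrightarrow> v i \<noteq> \<zero>\<^bsub>V i\<^esub>"
  shows "zz_monomorphism K (interval_module K M (lo M) (hi M)) M (\<lambda>i k. k \<odot>\<^bsub>V i\<^esub> v i)"
proof -
  have closed: "v i \<in> carrier (V i)" if "i \<in> vertices" for i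
    using v that by (simp add: thread_def)
  have "linear_map K (field_module K) (V i) (\<lambda>k. k \<odot>\<^bsub>V i\<^esub> v i)" if "i \<in> vertices" for i
  proof -
    interpret Vi: module K "V i" using module_V that by blast
    show ?thesis
      using closed[OF that] by (intro linear_mapI)
        (simp_all add: vectorspace_V[OF that] vectorspace_field_module field_K Vi.smult_l_distr Vi.smult_assoc1)
  qed
  moreover have "smap M i (k \<odot>\<^bsub>V (src M i)\<^esub> v (src M i)) = k \<odot>\<^bsub>V (tgt M i)\<^esub> v (tgt M i)"
    if "i \<in> edges" "k \<in> carrier K" for i k
    using linear_mapD(3)[OF smap_linear[OF that(1)] that(2) closed] edge_ends that v(1)
    by (auto simp: thread_def)
  ultimately show ?thesis
    unfolding zz_monomorphism_def zz_morphism_def same_type_def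
    using smult_inj_on[OF _ closed v(2)] edge_ends by simp
qed

section \<open>Coordinates along a thread\<close>

text \<open>Equality at the two ends of an arrow is symmetric, so one can walk right from
  \<open>b \<alpha>\<close> whatever the directions are. This serves for coordinates of threads and
  for a retraction evaluated on generators.\<close>

lemma constant_on_interval:
  assumes "\<alpha> \<in> A" "\<And>i. b \<alpha> \<le> i \<Longrightarrow> Suc i \<le> d \<alpha> \<Longrightarrow> i \<in> edges \<Longrightarrow> g (tgt M i) = g (src M i)"
    and "b \<alpha> \<le> i" "i \<le> d \<alpha>"
  shows "g i = g (b \<alpha>)"
  using assms(3,4)
proof (induction i rule: dec_induct)
  case (step i)
  then have "i \<in> edges" using bounds[OF assms(1)] by auto
  then have "g (Suc i) = g i"
    using assms(2)[of i] step by (auto simp: src_def tgt_def split: arrow.splits)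
  then show ?case using step by simp
qed simp

lemma thread_closed: "thread v \<Longrightarrow> i \<in> vertices \<Longrightarrow> v i \<in> carrier (V i)"
  by (simp add: thread_def)

lemma thread_coord_smap:
  assumes "thread v" "\<alpha> \<in> A" "i \<in> edges"
  shows "coord \<alpha> (tgt M i) (v (tgt M i)) =
    (if b \<alpha> \<le> i \<and> Suc i \<le> d \<alpha> then coord \<alpha> (src M i) (v (src M i)) else \<zero>\<^bsub>K\<^esub>)"
  using coord_smap[OF assms(2,3) thread_closed[OF assms(1) edge_ends(1)[OF assms(3)]]] assms
  by (simp add: thread_def)

lemma thread_coord_constant:
  assumes "thread v" "\<alpha> \<in> A" "b \<alpha> \<le> i" "i \<le> d \<alpha>"
  shows "coord \<alpha> i (v i) = coord \<alpha> (b \<alpha>) (v (b \<alpha>))"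
proof (rule constant_on_interval[OF assms(2) _ assms(3,4)])
  show "coord \<alpha> (tgt M i) (v (tgt M i)) = coord \<alpha> (src M i) (v (src M i))"
    if "b \<alpha> \<le> i" "Suc i \<le> d \<alpha>" "i \<in> edges" for i
    using thread_coord_smap[OF assms(1,2) that(3)] that by simp
qed

text \<open>The coordinate of a thread is constant on the interval of \<open>\<alpha>\<close>, so
  testing it at the left end decides it at every vertex there.\<close>

definition support :: "(nat \<Rightarrow> 'v) \<Rightarrow> 'a set" where
  "support v = {\<alpha>\<in>A. coord \<alpha> (b \<alpha>) (v (b \<alpha>)) \<noteq> \<zero>\<^bsub>K\<^esub>}"

text \<open>A forward arrow into \<open>b \<alpha>\<close> starts outside the interval, where the
  structure map on the summand is zero; the coordinate at \<open>b \<alpha>\<close> would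
  vanish.\<close>

lemma support_left:
  assumes "thread v" "\<alpha> \<in> support v" "lo M < b \<alpha>"
  shows "dir M (b \<alpha> - 1) = Backward"
proof (rule ccontr)
  assume "dir M (b \<alpha> - 1) \<noteq> Backward"
  then have "tgt M (b \<alpha> - 1) = b \<alpha>"
    using assms(3) by (cases "dir M (b \<alpha> - 1)") (auto simp: tgt_def)
  moreover have "b \<alpha> - 1 \<in> edges" "\<alpha> \<in> A" "coord \<alpha> (b \<alpha>) (v (b \<alpha>)) \<noteq> \<zero>\<^bsub>K\<^esub>"
    using assms bounds[of \<alpha>] by (auto simp: support_def)
  ultimately show False
    using thread_coord_smap[OF assms(1), of \<alpha> "b \<alpha> - 1"] assms(3) by (auto split: if_splits)
qed

text \<open>Mirror image of \<open>support_left\<close>: a backward arrow would end at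
  \<open>d \<alpha>\<close>, and constancy carries the nonzero coordinate from
  \<open>b \<alpha>\<close> to there.\<close>

lemma support_right:
  assumes "thread v" "\<alpha> \<in> support v" "d \<alpha> < hi M"
  shows "dir M (d \<alpha>) = Forward"
proof (rule ccontr)
  assume "dir M (d \<alpha>) \<noteq> Forward"
  then have "tgt M (d \<alpha>) = d \<alpha>"
    by (cases "dir M (d \<alpha>)") (auto simp: tgt_def)
  moreover have "d \<alpha> \<in> edges" "\<alpha> \<in> A" "coord \<alpha> (d \<alpha>) (v (d \<alpha>)) \<noteq> \<zero>\<^bsub>K\<^esub>"
    using assms bounds[of \<alpha>] thread_coord_constant[OF assms(1), of \<alpha> "d \<alpha>"] by (auto simp: support_def)
  ultimately show False
    using thread_coord_smap[OF assms(1), of \<alpha> "d \<alpha>"] by auto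
qed

text \<open>A nonzero vector has a nonzero coordinate, which can only belong to an interval
  containing its vertex.\<close>

lemma support_covers:
  assumes "thread v" "i \<in> vertices" "v i \<noteq> \<zero>\<^bsub>V i\<^esub>"
  shows "\<exists>\<alpha>\<in>support v. b \<alpha> \<le> i \<and> i \<le> d \<alpha>"
proof -
  note closed = thread_closed[OF assms(1,2)]
  obtain \<alpha> where \<alpha>: "\<alpha> \<in> A" "coord \<alpha> i (v i) \<noteq> \<zero>\<^bsub>K\<^esub>"
    using ex_coord_nonzero[OF assms(2) closed assms(3)] by blast
  then have i: "b \<alpha> \<le> i" "i \<le> d \<alpha>" using coord_outside[OF \<alpha>(1) assms(2) closed] by blast+
  then have "\<alpha> \<in> support v"
    using \<alpha> thread_coord_constant[OF assms(1) \<alpha>(1) i] by (simp add: support_def)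
  then show ?thesis using i by blast
qed

text \<open>The thread is the sum of the generators over \<open>S\<close>. The arrow conditions let
  no arrow enter an interval of \<open>S\<close>, so each of these generators is a thread by
  itself.\<close>

lemma thread_of_support:
  assumes "S \<subseteq> A"
    and left: "\<And>\<alpha>. \<alpha> \<in> S \<Longrightarrow> lo M < b \<alpha> \<Longrightarrow> dir M (b \<alpha> - 1) = Backward"
    and right: "\<And>\<alpha>. \<alpha> \<in> S \<Longrightarrow> d \<alpha> < hi M \<Longrightarrow> dir M (d \<alpha>) = Forward"
    and cover: "\<And>i. i \<in> vertices \<Longrightarrow> \<exists>\<alpha>\<in>S. b \<alpha> \<le> i \<and> i \<le> d \<alpha>"
  obtains v where "thread v" "support v = S" "\<And>i. i \<in> vertices \<Longrightarrow> v i \<noteq> \<zero>\<^bsub>V i\<^esub>"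
proof -
  \<comment> \<open>Padding with zero keeps the sum over all of \<open>A\<close>, so that
    \<open>component_unique\<close> reads off its components.\<close>
  define g where "g i \<alpha> = (if \<alpha> \<in> S then gen \<alpha> i else \<zero>\<^bsub>V i\<^esub>)" for i \<alpha>
  define v where "v i = (\<Oplus>\<^bsub>V i\<^esub>\<alpha>\<in>A. g i \<alpha>)" for i
  have g_in: "g i \<alpha> \<in> J \<alpha> i" if "\<alpha> \<in> A" "i \<in> vertices" for i \<alpha>
    using gen_in J_closed(2) that by (simp add: g_def)
  have g_Pi: "g i \<in> A \<rightarrow> carrier (V i)" if "i \<in> vertices" for i
    using g_in J_closed(1) that by auto
  have v_closed: "v i \<in> carrier (V i)" if "i \<in> vertices" for i
  proof -
    interpret Vi: module K "V i" using module_V that by blast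
    show ?thesis unfolding v_def using g_Pi[OF that] by (rule Vi.finsum_closed)
  qed
  have coord_v: "coord \<alpha> i (v i) = (if \<alpha> \<in> S \<and> b \<alpha> \<le> i \<and> i \<le> d \<alpha> then \<one>\<^bsub>K\<^esub> else \<zero>\<^bsub>K\<^esub>)"
    if "\<alpha> \<in> A" "i \<in> vertices" for \<alpha> i
  proof -
    have "component i (v i) \<alpha> = g i \<alpha>"
      using that g_in by (intro component_unique v_closed) (auto simp: v_def)
    then show ?thesis using that by (simp add: coord_def g_def f_gen f_zero)
  qed
  have g_smap: "smap M i (g (src M i) \<alpha>) = g (tgt M i) \<alpha>" if "i \<in> edges" "\<alpha> \<in> A" for i \<alpha>
  proof (cases "\<alpha> \<in> S")
    case True
    \<comment> \<open>The condition of \<open>gen_smap\<close>: an arrow from outside could only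
      enter at \<open>b \<alpha>\<close> going forward or at \<open>d \<alpha>\<close> going
      backward, which \<open>left\<close> and \<open>right\<close> exclude.\<close>
    have "b \<alpha> \<le> src M i \<and> src M i \<le> d \<alpha>" if "b \<alpha> \<le> tgt M i \<and> tgt M i \<le> d \<alpha>"
    proof (cases "dir M i")
      case Forward
      then have st: "src M i = i" "tgt M i = Suc i" by (auto simp: src_def tgt_def)
      have "b \<alpha> \<noteq> Suc i" using left[OF True] Forward \<open>i \<in> edges\<close> by auto
      then show ?thesis using that st by auto
    next
      case Backward
      then have st: "src M i = Suc i" "tgt M i = i" by (auto simp: src_def tgt_def)
      have "d \<alpha> \<noteq> i" using right[OF True] Backward \<open>i \<in> edges\<close> by auto
      then show ?thesis using that st by auto
    qed
    then show ?thesis using True that by (simp add: g_def gen_smap)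
  next
    case False
    interpret linear_map K "V (src M i)" "V (tgt M i)" "smap M i" using smap_linear that by blast
    show ?thesis using False by (simp add: g_def)
  qed
  have "smap M i (v (src M i)) = v (tgt M i)" if "i \<in> edges" for i
  proof -
    interpret T: module K "V (tgt M i)" using module_V edge_ends that by blast
    have "smap M i (v (src M i)) = (\<Oplus>\<^bsub>V (tgt M i)\<^esub>\<alpha>\<in>A. smap M i (g (src M i) \<alpha>))"
      unfolding v_def using linear_map_finsum[OF smap_linear g_Pi] that edge_ends by blast
    also have "\<dots> = v (tgt M i)"
      unfolding v_def using g_smap g_Pi edge_ends that by (intro T.finsum_cong') auto
    finally show ?thesis .
  qed
  then have "thread v" using v_closed by (simp add: thread_def)
  moreover have "support v = S"
  proof -
    have "coord \<alpha> (b \<alpha>) (v (b \<alpha>)) = (if \<alpha> \<in> S then \<one>\<^bsub>K\<^esub> else \<zero>\<^bsub>K\<^esub>)" if "\<alpha> \<in> A" for \<alpha>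
      using coord_v[OF that, of "b \<alpha>"] bounds[OF that] by simp
    then show ?thesis using \<open>S \<subseteq> A\<close> by (auto simp: support_def split: if_splits)
  qed
  moreover have "v i \<noteq> \<zero>\<^bsub>V i\<^esub>" if i: "i \<in> vertices" for i
  proof
    assume v0: "v i = \<zero>\<^bsub>V i\<^esub>"
    interpret Vi: module K "V i" using module_V that by blast
    obtain \<alpha> where \<alpha>: "\<alpha> \<in> S" "b \<alpha> \<le> i" "i \<le> d \<alpha>" using cover i by blast
    then have \<alpha>A: "\<alpha> \<in> A" using \<open>S \<subseteq> A\<close> by auto
    have "coord \<alpha> i (\<zero>\<^bsub>K\<^esub> \<odot>\<^bsub>V i\<^esub> v i) = \<zero>\<^bsub>K\<^esub>"
      using coord_smult[OF \<alpha>A i v_closed] coord_closed[OF \<alpha>A i v_closed] i by simp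
    then show False using coord_v[OF \<alpha>A i] \<alpha> v0 by simp
  qed
  ultimately show thesis by (rule that)
qed

section \<open>Splitting of a thread and full intervals\<close>

text \<open>The kernel of \<open>coord \<alpha>\<close> is a complement: it is preserved by the
  structure maps, and on the thread this coordinate is the same nonzero constant at every
  vertex.\<close>

lemma direct_summand_of_full_support:
  assumes v: "thread v" and \<alpha>: "\<alpha> \<in> support v" "b \<alpha> = lo M" "d \<alpha> = hi M"
    and W: "\<And>i. i \<in> vertices \<Longrightarrow> W i = line v i"
  shows "direct_summand K M W"
proof -
  have \<alpha>A: "\<alpha> \<in> A" using \<alpha> by (simp add: support_def)
  note closed = thread_closed[OF v]
  define c where "c = coord \<alpha> (b \<alpha>) (v (b \<alpha>))"
  have coord_v: "coord \<alpha> i (v i) = c" if "i \<in> vertices" for i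
    unfolding c_def using that \<alpha> by (intro thread_coord_constant[OF v \<alpha>A]) auto
  have "lo M \<in> vertices" using bounds[OF \<alpha>A] by auto
  then have c: "c \<in> carrier K" "c \<noteq> \<zero>\<^bsub>K\<^esub>"
    using \<alpha> coord_closed[OF \<alpha>A] closed by (auto simp: c_def support_def)
  then have inv_c: "inv\<^bsub>K\<^esub> c \<in> carrier K" "inv\<^bsub>K\<^esub> c \<otimes>\<^bsub>K\<^esub> c = \<one>\<^bsub>K\<^esub>"
    by (auto simp: K.field_Units)
  define U where "U i = {x \<in> carrier (V i). coord \<alpha> i x = \<zero>\<^bsub>K\<^esub>}" for i
  have U_subspace: "subspace K (U i) (V i)" if i: "i \<in> vertices" for i
  proof -
    interpret linear_map K "V i" "field_module K" "coord \<alpha> i" by (rule coord_linear[OF \<alpha>A i])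
    show ?thesis using kerT_is_subspace by (simp add: ker_def U_def)
  qed
  have line_subspace: "subspace K (line v i) (V i)" if i: "i \<in> vertices" for i
  proof -
    interpret Vi: module K "V i" using module_V i by blast
    have "LinearCombinations.submodule K (line v i) (V i)"
    proof (rule LinearCombinations.submodule.intro)
      show "x \<oplus>\<^bsub>V i\<^esub> y \<in> line v i" if "x \<in> line v i" "y \<in> line v i" for x y
        using that closed[OF i] by (auto simp: Vi.smult_l_distr[symmetric])
      show "k \<odot>\<^bsub>V i\<^esub> x \<in> line v i" if "k \<in> carrier K" "x \<in> line v i" for k x
        using that closed[OF i] by (auto simp: Vi.smult_assoc1[symmetric])
      show "\<zero>\<^bsub>V i\<^esub> \<in> line v i"
        using closed[OF i] by (intro image_eqI[of _ _ "\<zero>\<^bsub>K\<^esub>"]) auto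
    qed (use closed[OF i] Vi.module_axioms in auto)
    then show ?thesis using vectorspace_V[OF i] by (simp add: subspace_def)
  qed
  have "smap M i ` line v (src M i) \<subseteq> line v (tgt M i)" if i: "i \<in> edges" for i
    using linear_mapD(3)[OF smap_linear[OF i] _ closed[OF edge_ends(1)[OF i]]] v i by (auto simp: thread_def)
  then have "zz_submodule K M W"
    using line_subspace edge_ends W by (simp add: zz_submodule_def)
  moreover have "zz_submodule K M U"
  proof -
    have "smap M i x \<in> U (tgt M i)" if i: "i \<in> edges" and x: "x \<in> U (src M i)" for i x
      using x coord_smap[OF \<alpha>A i, of x] linear_mapD(1)[OF smap_linear[OF i], of x] by (simp add: U_def)
    then show ?thesis using U_subspace by (auto simp: zz_submodule_def)
  qed
  moreover have "line v i <+>\<^bsub>V i\<^esub> U i = carrier (V i)" if i: "i \<in> vertices" for i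
  proof (intro equalityI subsetI)
    interpret Vi: module K "V i" using module_V i by blast
    show "x \<in> carrier (V i)" if "x \<in> line v i <+>\<^bsub>V i\<^esub> U i" for x
      using that closed[OF i] by (auto simp: set_add_def' U_def)
    show "x \<in> line v i <+>\<^bsub>V i\<^esub> U i" if x: "x \<in> carrier (V i)" for x
    proof -
      \<comment> \<open>The coefficient for which \<open>x\<close> minus \<open>k\<close> times
        \<open>v i\<close> has coordinate zero.\<close>
      define k where "k = coord \<alpha> i x \<otimes>\<^bsub>K\<^esub> inv\<^bsub>K\<^esub> c"
      have cx: "coord \<alpha> i x \<in> carrier K" using coord_closed[OF \<alpha>A i x] .
      then have k: "k \<in> carrier K" "k \<otimes>\<^bsub>K\<^esub> c = coord \<alpha> i x"
        using inv_c c by (auto simp: k_def K.m_assoc)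
      define u where "u = x \<oplus>\<^bsub>V i\<^esub> (\<ominus>\<^bsub>K\<^esub> k) \<odot>\<^bsub>V i\<^esub> v i"
      have kv: "(\<ominus>\<^bsub>K\<^esub> k) \<odot>\<^bsub>V i\<^esub> v i \<in> carrier (V i)" using k closed[OF i] by simp
      have "coord \<alpha> i u = coord \<alpha> i x \<oplus>\<^bsub>K\<^esub> (\<ominus>\<^bsub>K\<^esub> k) \<otimes>\<^bsub>K\<^esub> c"
        unfolding u_def coord_add[OF \<alpha>A i x kv]
        using coord_smult[OF \<alpha>A i closed[OF i]] coord_v[OF i] k by simp
      also have "\<dots> = \<zero>\<^bsub>K\<^esub>" using k c cx by (simp add: K.l_minus K.r_neg)
      finally have "u \<in> U i" using x kv by (simp add: U_def u_def)
      moreover have "x = k \<odot>\<^bsub>V i\<^esub> v i \<oplus>\<^bsub>V i\<^esub> u"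
        using k x closed[OF i] by (simp add: u_def Vi.smult_l_minus Vi.M.a_lcomm[of _ x] Vi.M.r_neg)
      ultimately show ?thesis using k by (auto simp: set_add_def')
    qed
  qed
  moreover have "line v i \<inter> U i = {\<zero>\<^bsub>V i\<^esub>}" if i: "i \<in> vertices" for i
  proof -
    interpret Vi: module K "V i" using module_V i by blast
    have zero: "k = \<zero>\<^bsub>K\<^esub>" if "k \<in> carrier K" "coord \<alpha> i (k \<odot>\<^bsub>V i\<^esub> v i) = \<zero>\<^bsub>K\<^esub>" for k
      using coord_smult[OF \<alpha>A i closed[OF i]] coord_v[OF i] that c K.integral_iff by auto
    have "k \<odot>\<^bsub>V i\<^esub> v i = \<zero>\<^bsub>V i\<^esub>" if "k \<in> carrier K" "coord \<alpha> i (k \<odot>\<^bsub>V i\<^esub> v i) = \<zero>\<^bsub>K\<^esub>" for k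
      using zero[OF that] closed[OF i] by simp
    then have "line v i \<inter> U i \<subseteq> {\<zero>\<^bsub>V i\<^esub>}" by (auto simp: U_def)
    moreover have "\<zero>\<^bsub>V i\<^esub> \<in> line v i" "\<zero>\<^bsub>V i\<^esub> \<in> U i"
      using line_subspace[OF i] U_subspace[OF i]
      by (auto simp: subspace_def dest: LinearCombinations.submodule.zero_closed)
    ultimately show ?thesis by blast
  qed
  ultimately show ?thesis
    unfolding direct_summand_def using W by (intro conjI exI[of _ U]) auto
qed

text \<open>A complement yields a retraction \<open>r\<close> with value one on the thread, so at
  \<open>lo M\<close> some component of \<open>v\<close> survives under \<open>r\<close>. If its
  interval stopped before \<open>hi M\<close>, the forward arrow there would send the generator to
  zero, while \<open>r\<close> is unchanged along arrows.\<close>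

lemma full_support_of_direct_summand:
  assumes v: "thread v" "\<And>i. i \<in> vertices \<Longrightarrow> v i \<noteq> \<zero>\<^bsub>V i\<^esub>" and "lo M \<le> hi M"
    and W: "\<And>i. i \<in> vertices \<Longrightarrow> W i = line v i" and "direct_summand K M W"
  shows "\<exists>\<alpha>\<in>support v. b \<alpha> = lo M \<and> d \<alpha> = hi M"
proof -
  note closed = thread_closed[OF v(1)]
  obtain U where U: "zz_submodule K M U"
    and sum: "\<And>i. i \<in> vertices \<Longrightarrow> line v i <+>\<^bsub>V i\<^esub> U i = carrier (V i)"
    and int: "\<And>i. i \<in> vertices \<Longrightarrow> line v i \<inter> U i = {\<zero>\<^bsub>V i\<^esub>}"
    using \<open>direct_summand K M W\<close> W unfolding direct_summand_def by auto
  have "\<exists>r. linear_map K (V i) (field_module K) r \<and> r (v i) = \<one>\<^bsub>K\<^esub> \<and> (\<forall>u\<in>U i. r u = \<zero>\<^bsub>K\<^esub>) \<and>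
      (\<forall>x\<in>carrier (V i). \<exists>u\<in>U i. x = r x \<odot>\<^bsub>V i\<^esub> v i \<oplus>\<^bsub>V i\<^esub> u)" if i: "i \<in> vertices" for i
    by (rule projection_onto_line[OF vectorspace_V[OF i] closed[OF i] v(2)[OF i] _ sum[OF i] int[OF i]])
      (use U i in \<open>auto simp: zz_submodule_def\<close>)
  then obtain r where r_linear: "\<And>i. i \<in> vertices \<Longrightarrow> linear_map K (V i) (field_module K) (r i)"
    and r_v: "\<And>i. i \<in> vertices \<Longrightarrow> r i (v i) = \<one>\<^bsub>K\<^esub>"
    and r_U: "\<And>i u. i \<in> vertices \<Longrightarrow> u \<in> U i \<Longrightarrow> r i u = \<zero>\<^bsub>K\<^esub>"
    and r_decomp: "\<And>i x. i \<in> vertices \<Longrightarrow> x \<in> carrier (V i) \<Longrightarrow> \<exists>u\<in>U i. x = r i x \<odot>\<^bsub>V i\<^esub> v i \<oplus>\<^bsub>V i\<^esub> u"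
    by metis
  have r_zero: "r i \<zero>\<^bsub>V i\<^esub> = \<zero>\<^bsub>K\<^esub>" if "i \<in> vertices" for i
  proof -
    interpret linear_map K "V i" "field_module K" "r i" by (rule r_linear[OF that])
    show ?thesis using f0_is_0 by simp
  qed
  \<comment> \<open>Structure maps carry \<open>v\<close> to \<open>v\<close> and \<open>U\<close>
    into \<open>U\<close>, so they keep the coefficient of \<open>v\<close>.\<close>
  have r_smap: "r (tgt M i) (smap M i x) = r (src M i) x" if i: "i \<in> edges" and x: "x \<in> carrier (V (src M i))" for i x
  proof -
    note e = edge_ends[OF i]
    note s = linear_mapD[OF smap_linear[OF i]]
    note t = linear_mapD[OF r_linear[OF e(2)]]
    obtain u where u: "u \<in> U (src M i)" "x = r (src M i) x \<odot>\<^bsub>V (src M i)\<^esub> v (src M i) \<oplus>\<^bsub>V (src M i)\<^esub> u"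
      using r_decomp[OF e(1) x] by blast
    interpret S: module K "V (src M i)" using module_V e by blast
    interpret T: module K "V (tgt M i)" using module_V e by blast
    have k: "r (src M i) x \<in> carrier K" using linear_mapD(1)[OF r_linear[OF e(1)] x] by simp
    have "LinearCombinations.submodule K (U (src M i)) (V (src M i))" "smap M i ` U (src M i) \<subseteq> U (tgt M i)"
      using U i e by (auto simp: zz_submodule_def subspace_def)
    then have uc: "u \<in> carrier (V (src M i))" and su: "smap M i u \<in> U (tgt M i)"
      using u(1) LinearCombinations.submodule.subset by blast+
    have "smap M i x = smap M i (r (src M i) x \<odot>\<^bsub>V (src M i)\<^esub> v (src M i) \<oplus>\<^bsub>V (src M i)\<^esub> u)"
      using u(2) by simp
    also have "\<dots> = r (src M i) x \<odot>\<^bsub>V (tgt M i)\<^esub> v (tgt M i) \<oplus>\<^bsub>V (tgt M i)\<^esub> smap M i u"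
      using s k uc closed[OF e(1)] v(1) i by (simp add: thread_def)
    finally have "r (tgt M i) (smap M i x) =
        r (src M i) x \<otimes>\<^bsub>K\<^esub> r (tgt M i) (v (tgt M i)) \<oplus>\<^bsub>K\<^esub> r (tgt M i) (smap M i u)"
      using t k closed[OF e(2)] s(1)[OF uc] by simp
    then show ?thesis using r_v[OF e(2)] r_U[OF e(2) su] k by simp
  qed
  have l: "lo M \<in> vertices" using \<open>lo M \<le> hi M\<close> by simp
  \<comment> \<open>The components of \<open>v\<close> at \<open>lo M\<close> add up to a vector on
    which \<open>r\<close> is one, so \<open>r\<close> cannot vanish on all of them.\<close>
  have "\<exists>\<alpha>\<in>A. r (lo M) (component (lo M) (v (lo M)) \<alpha>) \<noteq> \<zero>\<^bsub>K\<^esub>"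
  proof (rule ccontr)
    interpret F: vectorspace K "field_module K" by (rule vectorspace_field_module[OF field_K])
    assume "\<not> ?thesis"
    then have
      "(\<Oplus>\<^bsub>field_module K\<^esub>\<alpha>\<in>A. r (lo M) (component (lo M) (v (lo M)) \<alpha>)) =
        (\<Oplus>\<^bsub>field_module K\<^esub>\<alpha>\<in>A. \<zero>\<^bsub>field_module K\<^esub>)"
      by (intro F.finsum_cong') auto
    moreover have "r (lo M) (\<Oplus>\<^bsub>V (lo M)\<^esub>\<alpha>\<in>A. component (lo M) (v (lo M)) \<alpha>) =
        (\<Oplus>\<^bsub>field_module K\<^esub>\<alpha>\<in>A. r (lo M) (component (lo M) (v (lo M)) \<alpha>))"
      using component_in[OF l closed[OF l]] J_closed(1)[OF _ l] by (intro linear_map_finsum[OF r_linear[OF l]]) auto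
    ultimately show False
      using component_sum[OF l closed[OF l]] r_v[OF l] by simp
  qed
  then obtain \<alpha> where \<alpha>: "\<alpha> \<in> A" and nonzero: "r (lo M) (component (lo M) (v (lo M)) \<alpha>) \<noteq> \<zero>\<^bsub>K\<^esub>"
    by blast
  note gen_closed = J_closed(1)[OF \<alpha> _ gen_in[OF \<alpha>]]
  note coord_c = coord_closed[OF \<alpha> l closed[OF l]]
  have "component (lo M) (v (lo M)) \<alpha> = coord \<alpha> (lo M) (v (lo M)) \<odot>\<^bsub>V (lo M)\<^esub> gen \<alpha> (lo M)"
    unfolding coord_def by (rule eq_smult_gen[OF \<alpha> l component_in[OF l closed[OF l] \<alpha>]])
  then have "r (lo M) (component (lo M) (v (lo M)) \<alpha>) = coord \<alpha> (lo M) (v (lo M)) \<otimes>\<^bsub>K\<^esub> r (lo M) (gen \<alpha> (lo M))"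
    using linear_mapD(3)[OF r_linear[OF l] coord_c gen_closed[OF l l]] by simp
  moreover have "r (lo M) (gen \<alpha> (lo M)) \<in> carrier K"
    using linear_mapD(1)[OF r_linear[OF l] gen_closed[OF l l]] by simp
  ultimately have coord_nz: "coord \<alpha> (lo M) (v (lo M)) \<noteq> \<zero>\<^bsub>K\<^esub>"
    and r_nz: "r (lo M) (gen \<alpha> (lo M)) \<noteq> \<zero>\<^bsub>K\<^esub>"
    using nonzero coord_c by auto
  \<comment> \<open>A nonzero coordinate at \<open>lo M\<close> places this vertex in the interval,
    which cannot begin earlier.\<close>
  have b: "b \<alpha> = lo M"
    using coord_outside[OF \<alpha> l closed[OF l]] coord_nz bounds[OF \<alpha>] by fastforce
  then have support: "\<alpha> \<in> support v" using \<alpha> coord_nz by (simp add: support_def)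
  have "d \<alpha> = hi M"
  proof (rule ccontr)
    assume "d \<alpha> \<noteq> hi M"
    then have dh: "d \<alpha> < hi M" using bounds[OF \<alpha>] by simp
    then have "dir M (d \<alpha>) = Forward" by (rule support_right[OF v(1) support])
    then have st: "src M (d \<alpha>) = d \<alpha>" "tgt M (d \<alpha>) = Suc (d \<alpha>)" by (auto simp: src_def tgt_def)
    have e: "d \<alpha> \<in> edges" "d \<alpha> \<in> vertices" "Suc (d \<alpha>) \<in> vertices" using dh bounds[OF \<alpha>] by auto
    have "r (d \<alpha>) (gen \<alpha> (d \<alpha>)) = r (b \<alpha>) (gen \<alpha> (b \<alpha>))"
    proof (rule constant_on_interval[OF \<alpha>])
      fix i assume i: "b \<alpha> \<le> i" "Suc i \<le> d \<alpha>" "i \<in> edges"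
      note ei = edge_ends[OF i(3)]
      have "smap M i (gen \<alpha> (src M i)) = gen \<alpha> (tgt M i)"
        using i by (intro gen_smap \<alpha>) (auto simp: src_def split: arrow.split)
      then show "r (tgt M i) (gen \<alpha> (tgt M i)) = r (src M i) (gen \<alpha> (src M i))"
        using r_smap[OF i(3) gen_closed[OF ei(1) ei(1)]] by simp
    qed (use bounds[OF \<alpha>] in auto)
    \<comment> \<open>The arrow leaves the interval, so the generator at its target is the zero
      vector.\<close>
    moreover have "smap M (d \<alpha>) (gen \<alpha> (d \<alpha>)) = gen \<alpha> (Suc (d \<alpha>))"
      using gen_smap[OF \<alpha> e(1)] st by simp
    then have "r (d \<alpha>) (gen \<alpha> (d \<alpha>)) = r (Suc (d \<alpha>)) (gen \<alpha> (Suc (d \<alpha>)))"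
      using r_smap[OF e(1), of "gen \<alpha> (d \<alpha>)"] gen_closed[OF e(2) e(2)] st by simp
    ultimately show False
      using gen_outside[OF \<alpha> e(3)] r_zero[OF e(3)] r_nz b by simp
  qed
  with b support show ?thesis by blast
qed

section \<open>Non-split monomorphisms and spanning breaker chains\<close>

text \<open>Both directions pass through the support of a thread: a chain is extracted from the
  support of a non-split monomorphism, and conversely the members of a chain serve as the support of
  a new thread.\<close>

lemma nonsplit_mono_iff_breaker_chain:
  assumes "lo M \<le> hi M"
  shows "(\<exists>\<iota>. zz_monomorphism K (interval_module K M (lo M) (hi M)) M \<iota> \<and>
           \<not> direct_summand K M (zz_image (interval_module K M (lo M) (hi M)) \<iota>))
     \<longleftrightarrow> (\<exists>\<alpha>s. breaker_chain K M A J \<alpha>s \<and> chain_spans K M J \<alpha>s (lo M) (hi M))"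
    (is "?mono \<longleftrightarrow> ?chain")
proof
  assume ?mono
  then obtain \<iota> where \<iota>: "zz_monomorphism K (interval_module K M (lo M) (hi M)) M \<iota>"
    and nonsplit: "\<not> direct_summand K M (zz_image (interval_module K M (lo M) (hi M)) \<iota>)" by blast
  define v where "v i = \<iota> i \<one>\<^bsub>K\<^esub>" for i
  have v: "thread v" "\<And>i. i \<in> vertices \<Longrightarrow> v i \<noteq> \<zero>\<^bsub>V i\<^esub>"
    and image: "\<And>i. i \<in> vertices \<Longrightarrow> zz_image (interval_module K M (lo M) (hi M)) \<iota> i = line v i"
    using zz_monomorphism_thread[OF \<iota>] unfolding v_def by blast+
  have SA: "support v \<subseteq> A" by (auto simp: support_def)
  obtain \<alpha>s where \<alpha>s: "2 \<le> length \<alpha>s" "set \<alpha>s \<subseteq> support v" "b (hd \<alpha>s) = lo M" "d (last \<alpha>s) = hi M"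
    and links: "\<And>j. Suc j < length \<alpha>s \<Longrightarrow> b (\<alpha>s ! j) < b (\<alpha>s ! Suc j) \<and> b (\<alpha>s ! Suc j) \<le> d (\<alpha>s ! j) \<and>
       d (\<alpha>s ! j) < d (\<alpha>s ! Suc j) \<and> dir M (b (\<alpha>s ! Suc j) - 1) = Backward \<and> dir M (d (\<alpha>s ! j)) = Forward"
  proof (rule spanning_chain_exists[of "support v" "lo M" "hi M" b d "dir M"])
    show "finite (support v)" using finite_subset[OF SA finite_A] .
    show "lo M \<le> b \<alpha> \<and> b \<alpha> \<le> d \<alpha> \<and> d \<alpha> \<le> hi M" if "\<alpha> \<in> support v" for \<alpha>
      using bounds that SA by blast
    \<comment> \<open>A full interval in the support would split the image off.\<close>
    show "\<not> (b \<alpha> = lo M \<and> d \<alpha> = hi M)" if "\<alpha> \<in> support v" for \<alpha>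
      using direct_summand_of_full_support[OF v(1) that _ _ image] nonsplit by blast
    show "\<exists>\<alpha>\<in>support v. b \<alpha> \<le> i \<and> i \<le> d \<alpha>" if "lo M \<le> i" "i \<le> hi M" for i
      using support_covers[OF v(1), of i] v(2) that by simp
  qed (use assms support_left[OF v(1)] support_right[OF v(1)] in auto)
  have nth: "\<alpha>s ! j \<in> A" if "j < length \<alpha>s" for j
    using \<alpha>s SA that by (meson nth_mem subsetD)
  have ne: "\<alpha>s \<noteq> []" using \<alpha>s by auto
  have ends: "hd \<alpha>s \<in> A" "last \<alpha>s \<in> A" using \<alpha>s(2) SA hd_in_set[OF ne] last_in_set[OF ne] by blast+
  have "breaker_pair K M (J (\<alpha>s ! j)) (J (\<alpha>s ! Suc j))" if "Suc j < length \<alpha>s" for j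
    unfolding breaker_pair_def using links[OF that] nth[of j] nth[of "Suc j"] that
    by (simp add: interval_summand_iff)
  then have "breaker_chain K M A J \<alpha>s"
    using \<alpha>s SA by (auto simp: breaker_chain_def)
  moreover have "chain_spans K M J \<alpha>s (lo M) (hi M)"
    using \<alpha>s ends by (simp add: chain_spans_def interval_summand_iff)
  ultimately show ?chain by blast
next
  assume ?chain
  then obtain \<alpha>s where len: "2 \<le> length \<alpha>s" and SA: "set \<alpha>s \<subseteq> A"
    and pairs: "\<And>j. Suc j < length \<alpha>s \<Longrightarrow> breaker_pair K M (J (\<alpha>s ! j)) (J (\<alpha>s ! Suc j))"
    and spans: "chain_spans K M J \<alpha>s (lo M) (hi M)"
    by (auto simp: breaker_chain_def)
  have nth: "\<alpha>s ! j \<in> A" if "j < length \<alpha>s" for j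
    using SA that by (meson nth_mem subsetD)
  have ne: "\<alpha>s \<noteq> []" using len by auto
  have "hd \<alpha>s \<in> A" "last \<alpha>s \<in> A" using SA hd_in_set[OF ne] last_in_set[OF ne] by blast+
  then have ends: "b (hd \<alpha>s) = lo M" "d (last \<alpha>s) = hi M"
    using spans by (auto simp: chain_spans_def interval_summand_iff)
  have links: "b (\<alpha>s ! j) < b (\<alpha>s ! Suc j)" "b (\<alpha>s ! Suc j) \<le> d (\<alpha>s ! j)" "d (\<alpha>s ! j) < d (\<alpha>s ! Suc j)"
    "dir M (b (\<alpha>s ! Suc j) - 1) = Backward" "dir M (d (\<alpha>s ! j)) = Forward" if "Suc j < length \<alpha>s" for j
    using pairs[OF that] nth[of j] nth[of "Suc j"] that by (auto simp: breaker_pair_def interval_summand_iff)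
  obtain v where v: "thread v" "support v = set \<alpha>s" "\<And>i. i \<in> vertices \<Longrightarrow> v i \<noteq> \<zero>\<^bsub>V i\<^esub>"
  proof (rule thread_of_support[OF SA])
    fix \<alpha> assume "\<alpha> \<in> set \<alpha>s"
    then obtain j where j: "j < length \<alpha>s" "\<alpha> = \<alpha>s ! j" by (auto simp: in_set_conv_nth)
    \<comment> \<open>The head starts at \<open>lo M\<close>, so here \<open>j\<close> is positive
      and the pair ending at \<open>j\<close> supplies the arrow.\<close>
    show "dir M (b \<alpha> - 1) = Backward" if "lo M < b \<alpha>"
      using links(4)[of "j - 1"] j that ends(1) ne by (cases j) (auto simp: hd_conv_nth)
    show "dir M (d \<alpha>) = Forward" if "d \<alpha> < hi M"
    proof -
      have "j \<noteq> length \<alpha>s - 1" using that ends(2) ne j by (auto simp: last_conv_nth)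
      then show ?thesis using links(5)[of j] j by auto
    qed
  next
    fix i assume "i \<in> vertices"
    moreover have "successively (\<lambda>x y. b y \<le> d x) \<alpha>s"
      using links(2) by (simp add: successively_conv_nth)
    ultimately show "\<exists>\<alpha>\<in>set \<alpha>s. b \<alpha> \<le> i \<and> i \<le> d \<alpha>"
      using ends ne by (intro chain_covers) auto
  qed blast
  let ?\<iota> = "\<lambda>i k. k \<odot>\<^bsub>V i\<^esub> v i"
  have "zz_image (interval_module K M (lo M) (hi M)) ?\<iota> i = line v i" if "i \<in> vertices" for i
    using that by (simp add: zz_image_def)
  \<comment> \<open>Both ends increase strictly along the chain: the first interval ends before the
    second does, and every later one starts after its predecessor.\<close>
  moreover have "\<not> (b \<alpha> = lo M \<and> d \<alpha> = hi M)" if "\<alpha> \<in> set \<alpha>s" for \<alpha>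
  proof -
    obtain j where j: "j < length \<alpha>s" "\<alpha> = \<alpha>s ! j" using \<open>\<alpha> \<in> set \<alpha>s\<close> by (auto simp: in_set_conv_nth)
    show ?thesis
    proof (cases j)
      case 0
      then have "d \<alpha> < d (\<alpha>s ! 1)" using links(3)[of 0] len j by simp
      then show ?thesis using bounds[OF nth[of 1]] len by auto
    next
      case (Suc i)
      then have "b (\<alpha>s ! i) < b \<alpha>" using links(1)[of i] j by simp
      then show ?thesis using bounds[OF nth[of i]] Suc j by auto
    qed
  qed
  ultimately have "\<not> direct_summand K M (zz_image (interval_module K M (lo M) (hi M)) ?\<iota>)"
    using full_support_of_direct_summand[OF v(1,3) assms] v(2) by blast
  with thread_zz_monomorphism[OF v(1,3)] show ?mono by blast
qed

end

theorem theorem1p1: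
  fixes K :: "('k, 'r) ring_scheme"
    and V :: "('k, 'v) zigzag"
    and n p q :: nat
    and A :: "'a set"
    and J :: "'a \<Rightarrow> nat \<Rightarrow> 'v set"
  assumes "field K"
    and "zigzag_module K V" and "lo V = 1" and "hi V = n"
    and "1 \<le> p" and "p \<le> q" and "q \<le> n"
    and "interval_decomposition K (zz_restrict V p q) A J"
  shows "(\<exists>\<iota>. zz_monomorphism K (interval_module K (zz_restrict V p q) p q) (zz_restrict V p q) \<iota> \<and>
              \<not> direct_summand K (zz_restrict V p q)
                   (zz_image (interval_module K (zz_restrict V p q) p q) \<iota>))
     \<longleftrightarrow> (\<exists>\<alpha>s. breaker_chain K (zz_restrict V p q) A J \<alpha>s \<and>
              chain_spans K (zz_restrict V p q) J \<alpha>s p q)"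
proof -
  let ?M = "zz_restrict V p q"
  have M_simps: "lo ?M = p" "hi ?M = q" "dir ?M = dir V" "vspace ?M = vspace V" "smap ?M = smap V"
    "src ?M = src V" "tgt ?M = tgt V"
    by (auto simp: zz_restrict_def src_def tgt_def)
  have zigzag: "zigzag_module K ?M"
    using assms(2-7) by (auto simp: zigzag_module_def M_simps)
  \<comment> \<open>Endpoints and isomorphism are packed into one triple, so that a single choice
    over \<open>A\<close> provides all the locale parameters consistently.\<close>
  have "\<forall>\<alpha>\<in>A. \<exists>bdf. interval_summand K ?M (J \<alpha>) (fst bdf) (fst (snd bdf)) \<and>
      zz_morphism K (zz_sub ?M (J \<alpha>)) (interval_module K ?M (fst bdf) (fst (snd bdf))) (snd (snd bdf)) \<and>
      (\<forall>i\<in>{lo ?M..hi ?M}. bij_betw (snd (snd bdf) i) (J \<alpha> i)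
        (if fst bdf \<le> i \<and> i \<le> fst (snd bdf) then carrier K else {\<zero>\<^bsub>K\<^esub>}))"
    using assms(8) by (simp add: interval_decomposition_def interval_summand_def zz_isomorphic_def split del: if_split)
  then obtain bdf where bdf: "\<forall>\<alpha>\<in>A. interval_summand K ?M (J \<alpha>) (fst (bdf \<alpha>)) (fst (snd (bdf \<alpha>))) \<and>
      zz_morphism K (zz_sub ?M (J \<alpha>)) (interval_module K ?M (fst (bdf \<alpha>)) (fst (snd (bdf \<alpha>)))) (snd (snd (bdf \<alpha>))) \<and>
      (\<forall>i\<in>{lo ?M..hi ?M}. bij_betw (snd (snd (bdf \<alpha>)) i) (J \<alpha> i)
        (if fst (bdf \<alpha>) \<le> i \<and> i \<le> fst (snd (bdf \<alpha>)) then carrier K else {\<zero>\<^bsub>K\<^esub>}))"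
    by (rule bchoice[THEN exE])
  interpret interval_decomposed K ?M A J "\<lambda>\<alpha>. fst (bdf \<alpha>)" "\<lambda>\<alpha>. fst (snd (bdf \<alpha>))" "\<lambda>\<alpha>. snd (snd (bdf \<alpha>))"
  proof (rule interval_decomposed.intro)
    show "zz_direct_sum K ?M A J" using assms(8) by (simp add: interval_decomposition_def)
  qed (use assms(1) zigzag bdf in \<open>auto simp: interval_summand_def split del: if_split\<close>)
  show ?thesis
    using nonsplit_mono_iff_breaker_chain assms(6) by (simp add: M_simps)
qed

end
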